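(* Let $(W,S)$ be an extended Weyl system of domestic or wild type, with simple system $S$ of size $n$, set of reflections $T$, and let $c$ be a Coxeter transformation of $(W,S)$. Then the Hurwitz action of the braid group $\mathcal B_n$ is transitive on the set of reduced reflection factorizations of $c$, namely on $\mathrm{Red}_T(c)=\{(t_1,\ldots,t_n)\in T^n \mid t_1\cdots t_n=c\}$.
   Context: Extended Coxeter-Dynkin diagram: given integers $r\ge 0$ and $p_1,\ldots,p_r\ge 1$, the vertex set is $Q=\{1,1^*\}\cup\{(i,j)\mid 1\le i\le r,\ 1\le j\le p_i\}$. Single edges join $(i,j)$ and $(i,j+1)$ for $1\le j<p_i$, join $1$ and $(i,1)$, and join $1^*$ and $(i,1)$, for all $i$. The vertices $1$ and $1^*$ are joined by a dotted double bond. There are no other edges. Extended space: $V$ is the real vector space with basis $B=\{\alpha_\nu\mid \nu\in Q\}$ and symmetric bilinear form given by $(\alpha_\nu\mid\alpha_\nu)=2$, $(\alpha_1\mid\alpha_{1^*})=2$, $(\alpha_\nu\mid\alpha_\omega)=-1$ if $\nu,\omega$ are joined by a single edge, and $(\alpha_\nu\mid\alpha_\omega)=0$ if $\nu\neq\omega$ are not joined. For $\alpha\in V$ with $(\alpha\mid\alpha)\ne0$ the reflection is $s_\alpha(v)=v-\frac{2(\alpha\mid v)}{(\alpha\mid\alpha)}\alpha$. Extended Weyl system: $S=\{s_\alpha\mid\alpha\in B\}$, $W=\langle S\rangle\le \mathrm{GL}(V)$, and $T=\bigcup_{w\in W}wSw^{-1}$ is the set of reflections. The signature (numbers of positive, negative,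 zero eigenvalues) of the form is $(|B|-2,1,1)$, $(|B|-2,0,2)$ or $(|B|-1,0,1)$, and $W$ is then called wild, tubular or domestic, respectively. Coxeter transformation: any element $c=\left(\prod_{\alpha\in B\setminus\{\alpha_1,\alpha_{1^*}\}}s_\alpha\right)s_{\alpha_1}s_{\alpha_{1^*}}$, where the first $|B|-2$ factors are taken in an arbitrary order. Hurwitz action: if $T$ is a conjugation-closed subset of a group, the braid group $\mathcal B_n$ with standard generators $\sigma_1,\ldots,\sigma_{n-1}$ acts on $T^n$ by $\sigma_i(g_1,\ldots,g_n)=(g_1,\ldots,g_{i-1},g_{i+1},g_{i+1}^{-1}g_ig_{i+1},g_{i+2},\ldots,g_n)$. *)

theory Defs
  imports
    "HOL-Analysis.Linear_Algebra"
    "HOL-Algebra.Generated_Groups"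
    "HOL-Algebra.Group_Action"
    "Jordan_Normal_Form.Char_Poly"
begin

section \<open>Extended Coxeter-Dynkin diagrams\<close>

text \<open>The vertex \<open>1\<close> is \<open>Base\<close>, the vertex \<open>1\<^sup>*\<close> is \<open>Base_star\<close> and \<open>(i, j)\<close> is \<open>Arm i j\<close>.
  The parameters \<open>r\<close> and \<open>p\<^sub>1, \<dots>, p\<^sub>r\<close> are given by a list \<open>p\<close> with \<open>r = length p\<close> and
  \<open>p\<^sub>i = p ! (i - 1)\<close>.\<close>

datatype vertex = Base | Base_star | Arm nat nat

definition vertices :: "nat list \<Rightarrow> vertex set" where
  "vertices p = {Base, Base_star} \<union>
     {Arm i j | i j. 1 \<le> i \<and> i \<le> length p \<and> 1 \<le> j \<and> j \<le> p ! (i - 1)}"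

definition single_edge :: "vertex \<Rightarrow> vertex \<Rightarrow> bool" where
  "single_edge \<nu> \<omega> \<longleftrightarrow>
     (\<exists>i j. {\<nu>, \<omega>} = {Arm i j, Arm i (j + 1)}) \<or>
     (\<exists>i. {\<nu>, \<omega>} = {Base, Arm i 1}) \<or>
     (\<exists>i. {\<nu>, \<omega>} = {Base_star, Arm i 1})"

definition dotted_edge :: "vertex \<Rightarrow> vertex \<Rightarrow> bool" where
  "dotted_edge \<nu> \<omega> \<longleftrightarrow> {\<nu>, \<omega>} = {Base, Base_star}"

definition gram_entry :: "vertex \<Rightarrow> vertex \<Rightarrow> real" where
  "gram_entry \<nu> \<omega> =
     (if \<nu> = \<omega> then 2 else if dotted_edge \<nu> \<omega> then 2 else if single_edge \<nu> \<omega> then -1 else 0)"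

section \<open>The extended space\<close>

locale extended_space =
  fixes p :: "nat list"
    and \<alpha> :: "vertex \<Rightarrow> 'v::real_vector"
    and form :: "'v \<Rightarrow> 'v \<Rightarrow> real"
  assumes arm_lengths: "\<forall>k \<in> set p. 1 \<le> k"
    and inj_basis: "inj_on \<alpha> (vertices p)"
    and independent_basis: "independent (\<alpha> ` vertices p)"
    and span_basis: "span (\<alpha> ` vertices p) = UNIV"
    and bilinear_form: "bilinear form"
    and form_basis: "\<And>\<nu> \<omega>. \<nu> \<in> vertices p \<Longrightarrow> \<omega> \<in> vertices p \<Longrightarrow>
           form (\<alpha> \<nu>) (\<alpha> \<omega>) = gram_entry \<nu> \<omega>"

section \<open>Signature\<close>

text \<open>The signature is read off the Gram matrix of the form in the basis \<open>\<alpha>\<close>. The vertices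
  are enumerated in some order to obtain a matrix; the characteristic polynomial does not depend on
  this order. Eigenvalues are counted with multiplicity.\<close>

definition vertex_list :: "nat list \<Rightarrow> vertex list" where
  "vertex_list p = Base # Base_star #
     concat (map (\<lambda>i. map (Arm i) [1..<p ! (i - 1) + 1]) [1..<length p + 1])"

lemma set_vertex_list: "set (vertex_list p) = vertices p"
proof (rule Set.set_eqI)
  fix \<nu>
  show "\<nu> \<in> set (vertex_list p) \<longleftrightarrow> \<nu> \<in> vertices p"
    by (cases \<nu>) (auto simp: vertex_list_def vertices_def image_iff Bex_def less_Suc_eq_le simp del: upt_Suc)
qed

lemma distinct_vertex_list: "distinct (vertex_list p)"
proof -
  have "distinct (concat (map (\<lambda>i. map (Arm i) (f i)) ks))"
    if "distinct ks" "\<And>i. distinct (f i)" for ks :: "nat list" and f :: "nat \<Rightarrow> nat list"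
    using that by (induction ks) (auto simp: distinct_map inj_on_def)
  from this[of "[1..<length p + 1]" "\<lambda>i. [1..<p ! (i - 1) + 1]"] show ?thesis
    by (auto simp: vertex_list_def simp del: upt_Suc)
qed

lemma length_vertex_list: "length (vertex_list p) = card (vertices p)"
  by (metis distinct_card distinct_vertex_list set_vertex_list)

definition gram_matrix :: "nat list \<Rightarrow> real mat" where
  "gram_matrix p = mat (card (vertices p)) (card (vertices p))
     (\<lambda>(a, b). gram_entry (vertex_list p ! a) (vertex_list p ! b))"

definition signature :: "nat list \<Rightarrow> nat \<times> nat \<times> nat" where
  "signature p = (let E = proots (char_poly (gram_matrix p)) in
     (size {#x \<in># E. x > 0#}, size {#x \<in># E. x < 0#}, size {#x \<in># E. x = 0#}))"

definition wild :: "nat list \<Rightarrow> bool" where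
  "wild p \<longleftrightarrow> signature p = (card (vertices p) - 2, 1, 1)"

definition domestic :: "nat list \<Rightarrow> bool" where
  "domestic p \<longleftrightarrow> signature p = (card (vertices p) - 1, 0, 1)"

section \<open>Extended Weyl systems and Coxeter transformations\<close>

definition GL :: "('v::real_vector \<Rightarrow> 'v) monoid" where
  "GL = \<lparr>carrier = {f. linear f \<and> bij f}, monoid.mult = (\<circ>), one = id\<rparr>"

lemma group_GL: "group (GL :: ('v::real_vector \<Rightarrow> 'v) monoid)"
proof (rule groupI)
  fix f :: "'v \<Rightarrow> 'v" assume "f \<in> carrier GL"
  then have f: "linear f" "bij f"
    by (simp_all add: GL_def)
  then obtain g where g: "linear g" "g \<circ> f = id"
    using linear_injective_left_inverse[of f] bij_is_inj by blast
  then have "inv_into UNIV f = g"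
    using f(2) by (metis bij_is_surj comp_assoc comp_id id_comp surj_iff)
  then have "linear (inv_into UNIV f)"
    using g by simp
  then show "\<exists>g \<in> carrier GL. g \<otimes>\<^bsub>GL\<^esub> f = \<one>\<^bsub>GL\<^esub>"
    using f by (intro bexI[of _ "inv_into UNIV f"]) (simp_all add: GL_def bij_imp_bij_inv bij_is_inj)
qed (auto simp: GL_def linear_compose bij_comp comp_assoc linear_id[unfolded id_def] id_def
      intro: bij_id[unfolded id_def])

definition reflection :: "('v::real_vector \<Rightarrow> 'v \<Rightarrow> real) \<Rightarrow> 'v \<Rightarrow> 'v \<Rightarrow> 'v" where
  "reflection form a v = v - (2 * form a v / form a a) *\<^sub>R a"

definition simple_reflections ::
    "nat list \<Rightarrow> (vertex \<Rightarrow> 'v::real_vector) \<Rightarrow> ('v \<Rightarrow> 'v \<Rightarrow> real) \<Rightarrow> ('v \<Rightarrow> 'v) set" where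
  "simple_reflections p \<alpha> form = reflection form ` \<alpha> ` vertices p"

definition weyl_group ::
    "nat list \<Rightarrow> (vertex \<Rightarrow> 'v::real_vector) \<Rightarrow> ('v \<Rightarrow> 'v \<Rightarrow> real) \<Rightarrow> ('v \<Rightarrow> 'v) set" where
  "weyl_group p \<alpha> form = generate GL (simple_reflections p \<alpha> form)"

definition reflections ::
    "nat list \<Rightarrow> (vertex \<Rightarrow> 'v::real_vector) \<Rightarrow> ('v \<Rightarrow> 'v \<Rightarrow> real) \<Rightarrow> ('v \<Rightarrow> 'v) set" where
  "reflections p \<alpha> form = (\<Union>w \<in> weyl_group p \<alpha> form.
     {w \<otimes>\<^bsub>GL\<^esub> s \<otimes>\<^bsub>GL\<^esub> inv\<^bsub>GL\<^esub> w | s. s \<in> simple_reflections p \<alpha> form})"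

definition group_prod :: "('g, 'b) monoid_scheme \<Rightarrow> 'g list \<Rightarrow> 'g" where
  "group_prod G ts = foldr (\<otimes>\<^bsub>G\<^esub>) ts \<one>\<^bsub>G\<^esub>"

definition coxeter_transformation ::
    "nat list \<Rightarrow> (vertex \<Rightarrow> 'v::real_vector) \<Rightarrow> ('v \<Rightarrow> 'v \<Rightarrow> real) \<Rightarrow> ('v \<Rightarrow> 'v) \<Rightarrow> bool" where
  "coxeter_transformation p \<alpha> form c \<longleftrightarrow>
     (\<exists>\<nu>s. distinct \<nu>s \<and> set \<nu>s = vertices p - {Base, Base_star} \<and>
        c = group_prod GL (map (\<lambda>\<nu>. reflection form (\<alpha> \<nu>)) (\<nu>s @ [Base, Base_star])))"

definition Red :: "('g, 'b) monoid_scheme \<Rightarrow> 'g set \<Rightarrow> nat \<Rightarrow> 'g \<Rightarrow> 'g list set" where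
  "Red G T n c = {ts. length ts = n \<and> set ts \<subseteq> T \<and> group_prod G ts = c}"

section \<open>Braid groups\<close>

text \<open>The braid group on \<open>n\<close> strands is given by Artin's presentation, as words modulo the
  congruence generated by the relations. A word is a list of signed indices: \<open>(True, i)\<close> stands for
  the generator \<open>\<sigma>\<^sub>i\<close> and \<open>(False, i)\<close> for its inverse, where \<open>1 \<le> i < n\<close>.\<close>

type_synonym braid_word = "(bool \<times> nat) list"

definition braid_words :: "nat \<Rightarrow> braid_word set" where
  "braid_words n = lists (UNIV \<times> {1..<n})"

inductive braid_eq :: "nat \<Rightarrow> braid_word \<Rightarrow> braid_word \<Rightarrow> bool" for n where
  refl: "w \<in> braid_words n \<Longrightarrow> braid_eq n w w"
| sym: "braid_eq n u v \<Longrightarrow> braid_eq n v u"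
| trans: "braid_eq n u v \<Longrightarrow> braid_eq n v w \<Longrightarrow> braid_eq n u w"
| append: "braid_eq n u u' \<Longrightarrow> braid_eq n v v' \<Longrightarrow> braid_eq n (u @ v) (u' @ v')"
| cancel: "i \<in> {1..<n} \<Longrightarrow> braid_eq n [(b, i), (\<not> b, i)] []"
| commute: "i \<in> {1..<n} \<Longrightarrow> j \<in> {1..<n} \<Longrightarrow> i + 2 \<le> j \<Longrightarrow>
    braid_eq n [(True, i), (True, j)] [(True, j), (True, i)]"
| braid: "i \<in> {1..<n} \<Longrightarrow> i + 1 \<in> {1..<n} \<Longrightarrow>
    braid_eq n [(True, i), (True, i + 1), (True, i)] [(True, i + 1), (True, i), (True, i + 1)]"

definition braid_rel :: "nat \<Rightarrow> (braid_word \<times> braid_word) set" where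
  "braid_rel n = {(u, v). braid_eq n u v}"

definition braid_group :: "nat \<Rightarrow> braid_word set monoid" where
  "braid_group n = \<lparr>carrier = braid_words n // braid_rel n,
     monoid.mult = (\<lambda>X Y. \<Union>u \<in> X. \<Union>v \<in> Y. braid_rel n `` {u @ v}),
     one = braid_rel n `` {[]}\<rparr>"

lemma braid_eq_words: "braid_eq n u v \<Longrightarrow> u \<in> braid_words n \<and> v \<in> braid_words n"
  by (induction rule: braid_eq.induct) (auto simp: braid_words_def)

lemma equiv_braid_rel: "equiv (braid_words n) (braid_rel n)"
proof (rule equivI)
  show "braid_rel n \<subseteq> braid_words n \<times> braid_words n"
    using braid_eq_words by (auto simp: braid_rel_def)
  show "refl_on (braid_words n) (braid_rel n)"
    by (simp add: refl_on_def braid_rel_def braid_eq.refl)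
  show "sym (braid_rel n)"
    by (rule symI) (simp add: braid_rel_def braid_eq.sym)
  show "trans (braid_rel n)"
    by (rule transI) (use braid_eq.trans in \<open>force simp: braid_rel_def\<close>)
qed

lemma braid_mult:
  assumes "u \<in> braid_words n" "v \<in> braid_words n"
  shows "braid_rel n `` {u} \<otimes>\<^bsub>braid_group n\<^esub> braid_rel n `` {v} = braid_rel n `` {u @ v}"
proof -
  have "braid_rel n `` {u' @ v'} = braid_rel n `` {u @ v}"
    if "u' \<in> braid_rel n `` {u}" "v' \<in> braid_rel n `` {v}" for u' v'
    using that by (intro equiv_class_eq[OF equiv_braid_rel])
      (simp add: braid_rel_def braid_eq.append braid_eq.sym)
  moreover have "u \<in> braid_rel n `` {u}" "v \<in> braid_rel n `` {v}"
    using assms by (auto simp: braid_rel_def intro: braid_eq.refl)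
  ultimately have "(\<Union>u' \<in> braid_rel n `` {u}. \<Union>v' \<in> braid_rel n `` {v}. braid_rel n `` {u' @ v'}) =
      braid_rel n `` {u @ v}"
    by blast
  then show ?thesis
    by (simp add: braid_group_def)
qed

lemma braid_words_append: "u \<in> braid_words n \<Longrightarrow> v \<in> braid_words n \<Longrightarrow> u @ v \<in> braid_words n"
  by (auto simp: braid_words_def)

lemma carrier_braid_group: "carrier (braid_group n) = braid_words n // braid_rel n"
  by (simp add: braid_group_def)

definition inverse_word :: "braid_word \<Rightarrow> braid_word" where
  "inverse_word w = map (\<lambda>(b, i). (\<not> b, i)) (rev w)"

lemma inverse_word_closed: "w \<in> braid_words n \<Longrightarrow> inverse_word w \<in> braid_words n"
  unfolding inverse_word_def by (induction w) (auto simp: braid_words_def)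

lemma inverse_inverse_word: "inverse_word (inverse_word w) = w"
  unfolding inverse_word_def by (induction w) auto

lemma braid_eq_inverse:
  assumes "w \<in> braid_words n"
  shows "braid_eq n (inverse_word w @ w) []"
  using assms
proof (induction w)
  case Nil
  then show ?case by (simp add: braid_eq.refl inverse_word_def)
next
  case (Cons a w)
  obtain b i where a: "a = (b, i)" by force
  let ?w = "inverse_word w"
  have i: "i \<in> {1..<n}" and w: "w \<in> braid_words n"
    using Cons.prems by (auto simp: a braid_words_def)
  have w': "?w \<in> braid_words n"
    using w by (rule inverse_word_closed)
  have "braid_eq n [(\<not> b, i), (b, i)] []"
    using braid_eq.cancel[OF i, of "\<not> b"] by simp
  from braid_eq.append[OF braid_eq.refl[OF w'] braid_eq.append[OF this braid_eq.refl[OF w]]]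
  have "braid_eq n (inverse_word (a # w) @ a # w) (?w @ w)"
    by (simp add: a inverse_word_def)
  then show ?case
    using Cons.IH[OF w] by (rule braid_eq.trans)
qed

lemma group_braid_group: "group (braid_group n)"
proof (rule groupI)
  fix X Y assume "X \<in> carrier (braid_group n)" "Y \<in> carrier (braid_group n)"
  then show "X \<otimes>\<^bsub>braid_group n\<^esub> Y \<in> carrier (braid_group n)"
    by (auto simp: braid_mult braid_words_append quotientI carrier_braid_group
        elim!: quotientE)
next
  show "\<one>\<^bsub>braid_group n\<^esub> \<in> carrier (braid_group n)"
    by (simp add: braid_group_def quotientI braid_words_def)
next
  fix X Y Z
  assume "X \<in> carrier (braid_group n)" "Y \<in> carrier (braid_group n)" "Z \<in> carrier (braid_group n)"
  then show "X \<otimes>\<^bsub>braid_group n\<^esub> Y \<otimes>\<^bsub>braid_group n\<^esub> Z = X \<otimes>\<^bsub>braid_group n\<^esub> (Y \<otimes>\<^bsub>braid_group n\<^esub> Z)"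
    by (auto simp: braid_mult braid_words_append carrier_braid_group
        elim!: quotientE)
next
  fix X assume X: "X \<in> carrier (braid_group n)"
  then obtain w where w: "w \<in> braid_words n" and X: "X = braid_rel n `` {w}"
    by (auto simp: braid_group_def elim!: quotientE)
  have one: "\<one>\<^bsub>braid_group n\<^esub> = braid_rel n `` {[]}" and nil: "[] \<in> braid_words n"
    by (simp_all add: braid_group_def braid_words_def)
  show "\<one>\<^bsub>braid_group n\<^esub> \<otimes>\<^bsub>braid_group n\<^esub> X = X"
    by (simp add: one X braid_mult w nil)
  let ?w = "inverse_word w"
  have w': "?w \<in> braid_words n"
    using w by (rule inverse_word_closed)
  have "braid_rel n `` {?w @ w} = braid_rel n `` {[]}"
    by (rule equiv_class_eq[OF equiv_braid_rel]) (simp add: braid_rel_def braid_eq_inverse w)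
  then have "braid_rel n `` {?w} \<otimes>\<^bsub>braid_group n\<^esub> X = \<one>\<^bsub>braid_group n\<^esub>"
    by (simp add: one X braid_mult w w')
  moreover have "braid_rel n `` {?w} \<in> carrier (braid_group n)"
    using w' by (simp add: braid_group_def quotientI)
  ultimately show "\<exists>Y \<in> carrier (braid_group n). Y \<otimes>\<^bsub>braid_group n\<^esub> X = \<one>\<^bsub>braid_group n\<^esub>"
    by blast
qed

section \<open>The Hurwitz action\<close>

text \<open>Tuples are lists, so the \<open>i\<close>-th component of a tuple \<open>ts\<close> is \<open>ts ! (i - 1)\<close>. The move of
  \<open>(False, i)\<close> is the inverse of the move of \<open>(True, i)\<close>. A word acts by the composition of the actions of its letters, and
  an element of the braid group acts by any of the words representing it, see
  \<open>hurwitz_word_cong\<close> below.\<close>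

fun hurwitz_move :: "('g, 'b) monoid_scheme \<Rightarrow> bool \<times> nat \<Rightarrow> 'g list \<Rightarrow> 'g list" where
  "hurwitz_move G (True, i) ts = (let g = ts ! (i - 1); h = ts ! i in
     ts[i - 1 := h, i := inv\<^bsub>G\<^esub> h \<otimes>\<^bsub>G\<^esub> g \<otimes>\<^bsub>G\<^esub> h])"
| "hurwitz_move G (False, i) ts = (let g = ts ! (i - 1); h = ts ! i in
     ts[i - 1 := g \<otimes>\<^bsub>G\<^esub> h \<otimes>\<^bsub>G\<^esub> inv\<^bsub>G\<^esub> g, i := g])"

definition hurwitz_word :: "('g, 'b) monoid_scheme \<Rightarrow> braid_word \<Rightarrow> 'g list \<Rightarrow> 'g list" where
  "hurwitz_word G w = foldr (hurwitz_move G) w"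

lemma hurwitz_word_append: "hurwitz_word G (u @ v) ts = hurwitz_word G u (hurwitz_word G v ts)"
  by (simp add: hurwitz_word_def)

lemma hurwitz_word_Nil: "hurwitz_word G [] ts = ts"
  by (simp add: hurwitz_word_def)

lemma hurwitz_word_Cons: "hurwitz_word G (a # w) ts = hurwitz_move G a (hurwitz_word G w ts)"
  by (simp add: hurwitz_word_def)

lemma length_hurwitz_move [simp]: "length (hurwitz_move G a ts) = length ts"
  by (cases "(G, a, ts)" rule: hurwitz_move.cases) (simp_all add: Let_def)

lemma group_cancel:
  assumes "group G" "x \<in> carrier G" "y \<in> carrier G"
  shows "inv\<^bsub>G\<^esub> x \<otimes>\<^bsub>G\<^esub> (x \<otimes>\<^bsub>G\<^esub> y) = y" "x \<otimes>\<^bsub>G\<^esub> (inv\<^bsub>G\<^esub> x \<otimes>\<^bsub>G\<^esub> y) = y"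
proof -
  interpret group G by fact
  show "inv\<^bsub>G\<^esub> x \<otimes>\<^bsub>G\<^esub> (x \<otimes>\<^bsub>G\<^esub> y) = y" "x \<otimes>\<^bsub>G\<^esub> (inv\<^bsub>G\<^esub> x \<otimes>\<^bsub>G\<^esub> y) = y"
    using assms(2,3) by (simp_all add: m_assoc[symmetric])
qed

lemma hurwitz_move_closed:
  assumes "\<And>x y. x \<in> T \<Longrightarrow> y \<in> T \<Longrightarrow> inv\<^bsub>G\<^esub> y \<otimes>\<^bsub>G\<^esub> x \<otimes>\<^bsub>G\<^esub> y \<in> T \<and> y \<otimes>\<^bsub>G\<^esub> x \<otimes>\<^bsub>G\<^esub> inv\<^bsub>G\<^esub> y \<in> T"
    and "i \<in> {1..<length ts}" "set ts \<subseteq> T"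
  shows "set (hurwitz_move G (b, i) ts) \<subseteq> T"
proof -
  have g: "ts ! (i - 1) \<in> T" and h: "ts ! i \<in> T"
    using assms(2,3) by (auto intro: nth_mem)
  show ?thesis
    using assms(1)[OF g h] assms(1)[OF h g] g h assms(3)
    by (cases b) (auto simp: Let_def dest!: set_update_subset_insert[THEN subsetD])
qed

lemma hurwitz_word_closed:
  assumes "\<And>x y. x \<in> T \<Longrightarrow> y \<in> T \<Longrightarrow> inv\<^bsub>G\<^esub> y \<otimes>\<^bsub>G\<^esub> x \<otimes>\<^bsub>G\<^esub> y \<in> T \<and> y \<otimes>\<^bsub>G\<^esub> x \<otimes>\<^bsub>G\<^esub> inv\<^bsub>G\<^esub> y \<in> T"
    and "w \<in> braid_words n" "length ts = n" "set ts \<subseteq> T"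
  shows "length (hurwitz_word G w ts) = n \<and> set (hurwitz_word G w ts) \<subseteq> T"
  using assms(2)
proof (induction w)
  case (Cons a w)
  then have "w \<in> braid_words n" "snd a \<in> {1..<n}"
    by (auto simp: braid_words_def)
  with Cons.IH hurwitz_move_closed[OF assms(1), where i = "snd a" and b = "fst a" and ts = "hurwitz_word G w ts"]
  show ?case
    by (simp add: hurwitz_word_Cons)
qed (use assms(3,4) in \<open>simp_all add: hurwitz_word_Nil\<close>)

lemma hurwitz_move_relations:
  assumes G: "group G" and ts: "set ts \<subseteq> carrier G"
  shows
    "i \<in> {1..<length ts} \<Longrightarrow> hurwitz_move G (b, i) (hurwitz_move G (\<not> b, i) ts) = ts"
    "i \<in> {1..<length ts} \<Longrightarrow> j \<in> {1..<length ts} \<Longrightarrow> i + 2 \<le> j \<Longrightarrow>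
       hurwitz_move G (True, i) (hurwitz_move G (True, j) ts) =
       hurwitz_move G (True, j) (hurwitz_move G (True, i) ts)"
    "i \<in> {1..<length ts} \<Longrightarrow> i + 1 \<in> {1..<length ts} \<Longrightarrow>
       hurwitz_move G (True, i) (hurwitz_move G (True, i + 1) (hurwitz_move G (True, i) ts)) =
       hurwitz_move G (True, i + 1) (hurwitz_move G (True, i) (hurwitz_move G (True, i + 1) ts))"
proof -
  interpret group G by fact
  have mem: "ts ! k \<in> carrier G" if "k < length ts" for k
    using ts that by auto
  show "hurwitz_move G (b, i) (hurwitz_move G (\<not> b, i) ts) = ts" if "i \<in> {1..<length ts}"
    using that mem[of i] mem[of "i - 1"]
    by (cases b; intro nth_equalityI)
      (auto simp: Let_def nth_list_update m_assoc group_cancel[OF G])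
  show "hurwitz_move G (True, i) (hurwitz_move G (True, j) ts) =
       hurwitz_move G (True, j) (hurwitz_move G (True, i) ts)"
    if "i \<in> {1..<length ts}" "j \<in> {1..<length ts}" "i + 2 \<le> j"
    using that by (intro nth_equalityI) (auto simp: Let_def nth_list_update)
  show "hurwitz_move G (True, i) (hurwitz_move G (True, i + 1) (hurwitz_move G (True, i) ts)) =
       hurwitz_move G (True, i + 1) (hurwitz_move G (True, i) (hurwitz_move G (True, i + 1) ts))"
    if "i \<in> {1..<length ts}" "i + 1 \<in> {1..<length ts}"
    using that mem[of i] mem[of "i - 1"] mem[of "i + 1"]
    by (intro nth_equalityI)
      (auto simp: Let_def nth_list_update m_assoc inv_mult_group group_cancel[OF G])
qed

lemma hurwitz_word_cong:
  assumes G: "group G" and "braid_eq n u v" and "length ts = n" and "set ts \<subseteq> carrier G"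
  shows "hurwitz_word G u ts = hurwitz_word G v ts"
  using assms(2-)
proof (induction arbitrary: ts rule: braid_eq.induct)
  case (append u u' v v')
  interpret group G by fact
  have "v' \<in> braid_words n"
    using append.hyps braid_eq_words by blast
  then have "length (hurwitz_word G v' ts) = n \<and> set (hurwitz_word G v' ts) \<subseteq> carrier G"
    using append.prems by (intro hurwitz_word_closed) auto
  then show ?case
    using append by (simp add: hurwitz_word_append)
next
  case (commute i j)
  then show ?case
    using hurwitz_move_relations(2)[OF G commute.prems(2), of i j]
    by (simp add: hurwitz_word_Nil hurwitz_word_Cons del: hurwitz_move.simps)
next
  case (braid i)
  then show ?case
    using hurwitz_move_relations(3)[OF G braid.prems(2), of i]
    by (simp add: hurwitz_word_Nil hurwitz_word_Cons del: hurwitz_move.simps)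
qed (use hurwitz_move_relations(1)[OF G] in
    \<open>simp_all add: hurwitz_word_Nil hurwitz_word_Cons del: hurwitz_move.simps\<close>)

lemma group_prod_hurwitz_move:
  assumes G: "group G" and "i \<in> {1..<length ts}" and ts: "set ts \<subseteq> carrier G"
  shows "group_prod G (hurwitz_move G (b, i) ts) = group_prod G ts"
proof -
  interpret group G by fact
  define us vs where "us = take (i - 1) ts" and "vs = drop (i + 1) ts"
  define g h where "g = ts ! (i - 1)" and "h = ts ! i"
  have "drop (i - 1) ts = g # h # vs"
  proof -
    have "i - 1 < length ts" "i < length ts" "Suc (i - 1) = i"
      using assms(2) by auto
    then show ?thesis
      using Cons_nth_drop_Suc[of "i - 1" ts] Cons_nth_drop_Suc[of i ts]
      unfolding g_def h_def vs_def by simp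
  qed
  then have split: "ts = us @ g # h # vs"
    by (metis append_take_drop_id us_def)
  have len: "length us = i - 1" "i = Suc (length us)"
    using assms(2) by (auto simp: us_def)
  have P: "group_prod G (xs @ ys) = foldr (\<otimes>\<^bsub>G\<^esub>) xs (group_prod G ys)" for xs ys
    by (simp add: group_prod_def)
  have closed: "group_prod G xs \<in> carrier G" if "set xs \<subseteq> carrier G" for xs
    using that by (induction xs) (auto simp: group_prod_def)
  have gh: "g \<in> carrier G" "h \<in> carrier G" "group_prod G vs \<in> carrier G"
    using ts closed[of vs] by (auto simp: split)
  have cons: "group_prod G (x # xs) = x \<otimes>\<^bsub>G\<^esub> group_prod G xs" for x xs
    by (simp add: group_prod_def)
  have m: "hurwitz_move G (True, i) ts = us @ h # (inv\<^bsub>G\<^esub> h \<otimes>\<^bsub>G\<^esub> g \<otimes>\<^bsub>G\<^esub> h) # vs"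
      "hurwitz_move G (False, i) ts = us @ (g \<otimes>\<^bsub>G\<^esub> h \<otimes>\<^bsub>G\<^esub> inv\<^bsub>G\<^esub> g) # g # vs"
    unfolding split len(2) by (simp_all add: Let_def nth_append list_update_append)
  show ?thesis
    using gh by (cases b) (simp_all only: m, simp_all add: split P cons m_assoc group_cancel[OF G])
qed

text \<open>The action is restricted to an invariant set \<open>E\<close> of tuples, in the form expected by
  the locale \<^locale>\<open>group_action\<close>.\<close>

definition hurwitz_action ::
    "('g, 'b) monoid_scheme \<Rightarrow> 'g list set \<Rightarrow> braid_word set \<Rightarrow> 'g list \<Rightarrow> 'g list" where
  "hurwitz_action G E X = (\<lambda>ts \<in> E. hurwitz_word G (SOME w. w \<in> X) ts)"

lemma hurwitz_group_action:
  assumes G: "group G" and T: "T \<subseteq> carrier G"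
    and conj: "\<And>x y. x \<in> T \<Longrightarrow> y \<in> T \<Longrightarrow> inv\<^bsub>G\<^esub> y \<otimes>\<^bsub>G\<^esub> x \<otimes>\<^bsub>G\<^esub> y \<in> T \<and> y \<otimes>\<^bsub>G\<^esub> x \<otimes>\<^bsub>G\<^esub> inv\<^bsub>G\<^esub> y \<in> T"
  shows "group_action (braid_group n) (Red G T n c) (hurwitz_action G (Red G T n c))"
proof -
  let ?E = "Red G T n c"
  let ?\<phi> = "hurwitz_action G ?E"
  have closed: "hurwitz_word G w ts \<in> ?E" if w: "w \<in> braid_words n" and ts: "ts \<in> ?E" for w ts
    using w
  proof (induction w)
    case (Cons a w)
    obtain b i where a: "a = (b, i)" by force
    have IH: "hurwitz_word G w ts \<in> ?E" and i: "i \<in> {1..<n}"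
      using Cons by (auto simp: a braid_words_def)
    then show ?case
      using hurwitz_move_closed[OF conj, of i "hurwitz_word G w ts" b]
        group_prod_hurwitz_move[OF G, of i "hurwitz_word G w ts" b] T
      by (auto simp: Red_def a hurwitz_word_Cons)
  qed (use ts in \<open>simp add: hurwitz_word_Nil\<close>)
  have cong: "hurwitz_word G u ts = hurwitz_word G v ts" if "braid_eq n u v" "ts \<in> ?E" for u v ts
    using hurwitz_word_cong[OF G that(1), of ts] that(2) T by (auto simp: Red_def)
  have act: "?\<phi> (braid_rel n `` {w}) = (\<lambda>ts \<in> ?E. hurwitz_word G w ts)" if "w \<in> braid_words n" for w
  proof -
    have "w \<in> braid_rel n `` {w}"
      using that by (simp add: braid_rel_def braid_eq.refl)
    then have "(SOME u. u \<in> braid_rel n `` {w}) \<in> braid_rel n `` {w}"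
      by (rule someI)
    then show ?thesis
      unfolding hurwitz_action_def
      by (intro restrict_ext) (auto simp: braid_rel_def intro: cong[symmetric])
  qed
  have inverse: "hurwitz_word G (inverse_word w) (hurwitz_word G w ts) = ts"
    if "w \<in> braid_words n" "ts \<in> ?E" for w ts
    using cong[OF braid_eq_inverse[OF that(1)] that(2)]
    by (simp add: hurwitz_word_append hurwitz_word_Nil)
  have bij: "(\<lambda>ts \<in> ?E. hurwitz_word G w ts) \<in> Bij ?E" if w: "w \<in> braid_words n" for w
  proof -
    have "bij_betw (hurwitz_word G w) ?E ?E"
    proof (rule bij_betw_byWitness[where f' = "hurwitz_word G (inverse_word w)"])
      show "\<forall>ts \<in> ?E. hurwitz_word G w (hurwitz_word G (inverse_word w) ts) = ts"
        using inverse[OF inverse_word_closed[OF w]] by (simp add: inverse_inverse_word)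
    qed (use inverse closed w inverse_word_closed in auto)
    then show ?thesis
      by (simp add: Bij_def)
  qed
  have "?\<phi> \<in> hom (braid_group n) (BijGroup ?E)"
  proof (rule homI)
    show "?\<phi> X \<in> carrier (BijGroup ?E)" if "X \<in> carrier (braid_group n)" for X
      using that by (auto simp: carrier_braid_group BijGroup_def act bij elim!: quotientE)
    show "?\<phi> (X \<otimes>\<^bsub>braid_group n\<^esub> Y) = ?\<phi> X \<otimes>\<^bsub>BijGroup ?E\<^esub> ?\<phi> Y"
      if X: "X \<in> carrier (braid_group n)" and Y: "Y \<in> carrier (braid_group n)" for X Y
    proof -
      obtain u v where u: "u \<in> braid_words n" "X = braid_rel n `` {u}"
        and v: "v \<in> braid_words n" "Y = braid_rel n `` {v}"
        using X Y by (auto simp: carrier_braid_group elim!: quotientE)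
      show ?thesis
        using closed[OF v(1)]
        by (auto simp: u v braid_mult act braid_words_append BijGroup_def bij compose_def
            hurwitz_word_append fun_eq_iff)
    qed
  qed
  then show ?thesis
    by (simp add: group_action_def group_hom_def group_hom_axioms_def group_braid_group group_BijGroup)
qed

end

theory Submission
  imports Defs
begin

text \<open>The vector \<open>\<delta> = \<alpha> Base_star - \<alpha> Base\<close> lies in the radical, and modulo \<open>\<delta>\<close> the group becomes the Coxeter
  group of the star-shaped tree without \<open>Base_star\<close>, while \<open>c\<close> becomes the product of the \<open>n - 2\<close> distinct
  simple reflections of the arms. A factorization of this product into \<open>n\<close> reflections is a path
  in the Bruhat graph; the Hurwitz moves inside dihedral reflection subgroups remove its peaks, until a
  pair \<open>(t, t)\<close> splits off or the path ascends, and then the exchange condition sorts it. So every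
  factorization is equivalent to one which is, modulo \<open>\<delta>\<close>, the list of arm reflections followed by a
  pair \<open>(t, t)\<close> with \<open>t\<close> the reflection in some root \<open>g\<close>.

  In the domestic and wild cases \<open>\<delta>\<close> spans the radical. Comparing the transvections along \<open>\<delta>\<close> on both
  sides of the factorization shows that \<open>g\<close> has coefficient \<open>\<plusminus> 1\<close> at \<open>Base\<close> and that the last two roots are
  neighbours \<open>g + k \<delta>\<close>, \<open>g + (k + 1) \<delta>\<close>. Moving this pair through the list conjugates it by the arm
  reflections, which transforms \<open>g\<close> into \<open>\<alpha> Base\<close>; the infinite dihedral group of the pair shifts \<open>k\<close> to
  \<open>0\<close>; and then all other factors are determined.\<close>

section \<open>Hurwitz equivalence of lists of roots\<close>

text \<open>A list of vectors stands for the list of its reflections. Opposite vectors define the same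
  reflection, hence the rule \<open>neg\<close>.\<close>

inductive hurwitz_eq :: "('v::real_vector \<Rightarrow> 'v \<Rightarrow> real) \<Rightarrow> 'v list \<Rightarrow> 'v list \<Rightarrow> bool"
  for form where
  refl: "hurwitz_eq form xs xs"
| trans: "hurwitz_eq form xs ys \<Longrightarrow> hurwitz_eq form ys zs \<Longrightarrow> hurwitz_eq form xs zs"
| right: "hurwitz_eq form (us @ a # b # vs) (us @ b # reflection form b a # vs)"
| left: "hurwitz_eq form (us @ a # b # vs) (us @ reflection form a b # a # vs)"
| neg: "hurwitz_eq form (us @ a # vs) (us @ (- a) # vs)"

lemma hurwitz_eq_context:
  "hurwitz_eq form xs ys \<Longrightarrow> hurwitz_eq form (us @ xs @ vs) (us @ ys @ vs)"
proof (induction rule: hurwitz_eq.induct)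
  case (right us' a b vs')
  show ?case using hurwitz_eq.right[of form "us @ us'" a b "vs' @ vs"] by simp
next
  case (left us' a b vs')
  show ?case using hurwitz_eq.left[of form "us @ us'" a b "vs' @ vs"] by simp
next
  case (neg us' a vs')
  show ?case using hurwitz_eq.neg[of form "us @ us'" a "vs' @ vs"] by simp
qed (auto intro: hurwitz_eq.intros)

lemma hurwitz_eq_length: "hurwitz_eq form xs ys \<Longrightarrow> length xs = length ys"
  by (induction rule: hurwitz_eq.induct) auto

lemma hurwitz_eq_closed:
  assumes "hurwitz_eq form xs ys"
    and "\<And>a b. a \<in> R \<Longrightarrow> b \<in> R \<Longrightarrow> reflection form a b \<in> R" and "\<And>a. a \<in> R \<Longrightarrow> - a \<in> R"
  shows "set xs \<subseteq> R \<Longrightarrow> set ys \<subseteq> R"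
  using assms(1) by (induction rule: hurwitz_eq.induct) (auto intro: assms)

section \<open>Products of reflections and elementary Hurwitz moves\<close>

definition reflection_prod ::
    "('v::real_vector \<Rightarrow> 'v \<Rightarrow> real) \<Rightarrow> 'v list \<Rightarrow> 'v \<Rightarrow> 'v" where
  "reflection_prod form xs = foldr (\<lambda>a f. reflection form a \<circ> f) xs id"

lemma reflection_prod_Nil [simp]: "reflection_prod form [] = id"
  by (simp add: reflection_prod_def)

lemma reflection_prod_Cons [simp]:
  "reflection_prod form (a # xs) = reflection form a \<circ> reflection_prod form xs"
  by (simp add: reflection_prod_def)

lemma reflection_prod_append [simp]:
  "reflection_prod form (xs @ ys) = reflection_prod form xs \<circ> reflection_prod form ys"
  by (induction xs) (auto simp: comp_assoc)

lemma reflection_uminus: "bilinear form \<Longrightarrow> reflection form (- a) = reflection form a"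
  by (rule ext) (simp add: reflection_def bilinear_lneg bilinear_rneg)

locale symmetric_form =
  fixes form :: "'v::real_vector \<Rightarrow> 'v \<Rightarrow> real"
  assumes bilinear: "bilinear form" and sym: "form x y = form y x"
begin

abbreviation s :: "'v \<Rightarrow> 'v \<Rightarrow> 'v" where "s \<equiv> reflection form"
abbreviation P :: "'v list \<Rightarrow> 'v \<Rightarrow> 'v" where "P \<equiv> reflection_prod form"
abbreviation heq (infix \<open>\<simeq>\<close> 50) where "heq \<equiv> hurwitz_eq form"
abbreviation norm2 :: "'v set" where "norm2 \<equiv> {v. form v v = 2}"

lemmas form_simps [simp] =
  bilinear_ladd[OF bilinear] bilinear_radd[OF bilinear] bilinear_lsub[OF bilinear]
  bilinear_rsub[OF bilinear] bilinear_lneg[OF bilinear] bilinear_rneg[OF bilinear]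
  bilinear_lmul[OF bilinear] bilinear_rmul[OF bilinear] bilinear_lzero[OF bilinear]
  bilinear_rzero[OF bilinear]

lemma s_eq: "form a a = 2 \<Longrightarrow> s a v = v - form a v *\<^sub>R a"
  by (simp add: reflection_def)

lemma linear_s: "linear (s a)"
  by (rule linearI) (simp_all add: reflection_def algebra_simps add_divide_distrib)

lemma s_self [simp]: "form a a = 2 \<Longrightarrow> s a a = - a"
  by (simp add: s_eq algebra_simps scaleR_2)

lemma s_s [simp]: "form a a = 2 \<Longrightarrow> s a (s a v) = v"
  by (simp add: s_eq algebra_simps)

lemma s_comp_s [simp]: "form a a = 2 \<Longrightarrow> s a \<circ> s a = id"
  by auto

lemma s_comp_s_left [simp]: "form a a = 2 \<Longrightarrow> s a \<circ> (s a \<circ> f) = f"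
  by (simp add: comp_assoc[symmetric])

lemma s_uminus [simp]: "s (- a) = s a"
  by (rule reflection_uminus[OF bilinear])

lemma form_s_s [simp]: "form a a = 2 \<Longrightarrow> form (s a u) (s a v) = form u v"
  by (simp add: s_eq algebra_simps sym)

lemma s_conjugate: "form a a = 2 \<Longrightarrow> s (s a b) = s a \<circ> s b \<circ> s a"
  by (rule ext) (simp add: reflection_def[of form b] reflection_def[of form "s a b"]
      linear_diff[OF linear_s] linear_scale[OF linear_s]
      form_s_s[of a b "s a v" for v, simplified])

lemma linear_P: "linear (P xs)"
proof (induction xs)
  case (Cons a xs)
  then show ?case unfolding reflection_prod_Cons by (rule linear_compose[OF _ linear_s])
qed (simp only: reflection_prod_Nil linear_id)

lemma form_P [simp]: "set xs \<subseteq> norm2 \<Longrightarrow> form (P xs u) (P xs v) = form u v"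
  by (induction xs) auto

lemma P_rev [simp]:
  "set xs \<subseteq> norm2 \<Longrightarrow> P (rev xs) (P xs v) = v"
  "set xs \<subseteq> norm2 \<Longrightarrow> P xs (P (rev xs) v) = v"
  by (induction xs arbitrary: v) auto

lemma s_P_conjugate:
  "set xs \<subseteq> norm2 \<Longrightarrow> s (P xs b) \<circ> P xs = P xs \<circ> s b"
proof (induction xs arbitrary: b)
  case (Cons a xs)
  then have "s (P (a # xs) b) \<circ> P (a # xs) = s a \<circ> (s (P xs b) \<circ> P xs)"
    by (simp add: s_conjugate comp_assoc)
  also have "\<dots> = s a \<circ> (P xs \<circ> s b)"
    by (subst Cons.IH) (use Cons.prems in auto)
  finally show ?case by (simp only: reflection_prod_Cons comp_assoc)
qed simp

lemma s_P_eq: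
  assumes "set xs \<subseteq> norm2"
  shows "s (P xs b) = P xs \<circ> s b \<circ> P (rev xs)"
proof
  fix v
  have "s (P xs b) v = (s (P xs b) \<circ> P xs) (P (rev xs) v)"
    using P_rev(2)[OF assms, of v] by simp
  then show "s (P xs b) v = (P xs \<circ> s b \<circ> P (rev xs)) v"
    by (simp only: s_P_conjugate[OF assms] o_apply)
qed

lemma heq_prod: "xs \<simeq> ys \<Longrightarrow> set xs \<subseteq> norm2 \<Longrightarrow> P ys = P xs \<and> set ys \<subseteq> norm2"
proof (induction rule: hurwitz_eq.induct)
  case (right us a b vs)
  then show ?case by (simp add: s_conjugate comp_assoc)
next
  case (left us a b vs)
  then show ?case by (simp add: s_conjugate comp_assoc)
qed auto

text \<open>\<open>right\<close> and \<open>left\<close> undo each other because reflections in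
  vectors of \<open>norm2\<close> are involutions.\<close>

lemma heq_sym: "xs \<simeq> ys \<Longrightarrow> set xs \<subseteq> norm2 \<Longrightarrow> ys \<simeq> xs"
proof (induction rule: hurwitz_eq.induct)
  case (trans xs ys zs)
  then show ?case using heq_prod hurwitz_eq.trans by blast
next
  case (right us a b vs)
  then show ?case using hurwitz_eq.left[of form us b "s b a" vs] by simp
next
  case (left us a b vs)
  then show ?case using hurwitz_eq.right[of form us "s a b" a vs] by simp
next
  case (neg us a vs)
  then show ?case using hurwitz_eq.neg[of form us "- a" vs] by simp
qed (rule hurwitz_eq.refl)

lemma heq_move_right:
  "set xs \<subseteq> norm2 \<Longrightarrow> a # xs \<simeq> map (s a) xs @ [a]"
proof (induction xs)
  case (Cons x xs)
  have "a # x # xs \<simeq> s a x # a # xs"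
    using hurwitz_eq.left[of form "[]" a x xs] by simp
  moreover have "s a x # a # xs \<simeq> s a x # map (s a) xs @ [a]"
    using hurwitz_eq_context[OF Cons.IH, of "[s a x]" "[]"] Cons.prems by simp
  ultimately show ?case by (auto intro: hurwitz_eq.trans)
qed (simp add: hurwitz_eq.refl)

text \<open>Here the moving root absorbs every conjugation, whereas in \<open>heq_move_right\<close>
  the roots that are passed get conjugated.\<close>

lemma heq_move_left:
  "set xs \<subseteq> norm2 \<Longrightarrow> xs @ [b] \<simeq> P xs b # xs"
proof (induction xs)
  case (Cons x xs)
  have "x # xs @ [b] \<simeq> x # P xs b # xs"
    using hurwitz_eq_context[OF Cons.IH, of "[x]" "[]"] Cons.prems by simp
  moreover have "x # P xs b # xs \<simeq> s x (P xs b) # x # xs"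
    using hurwitz_eq.left[of form "[]" x "P xs b" xs] by simp
  ultimately show ?case by (auto intro: hurwitz_eq.trans)
qed (simp add: hurwitz_eq.refl)

text \<open>Each root of \<open>xs\<close> is conjugated by \<open>s b\<close> twice, hence is
  unchanged in the end.\<close>

lemma heq_move_pair_right:
  assumes "form b b = 2" "set xs \<subseteq> norm2"
  shows "b # b # xs \<simeq> xs @ [b, b]"
proof -
  have "b # b # xs \<simeq> b # map (s b) xs @ [b]"
    using hurwitz_eq_context[OF heq_move_right[OF assms(2), of b], of "[b]" "[]"] by simp
  moreover have "set (map (s b) xs) \<subseteq> norm2"
    using assms by auto
  then have "b # map (s b) xs @ [b] \<simeq> map (s b) (map (s b) xs) @ [b] @ [b]"
    using hurwitz_eq_context[OF heq_move_right, of "map (s b) xs" "[]" b "[b]"]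
    by (simp del: map_map)
  moreover have "map (s b) (map (s b) xs) = xs"
    using assms(1) by (induction xs) auto
  ultimately show ?thesis by (auto intro: hurwitz_eq.trans)
qed

end

section \<open>Simply laced Coxeter groups\<close>

text \<open>For \<open>A\<close> inside \<open>norm2\<close> these are the real roots, the orbit of
  \<open>A\<close> under the group generated by its reflections. Only reflections in
  \<open>A\<close> are applied, so that induction follows words in the generators.\<close>

inductive_set root_system :: "('v::real_vector \<Rightarrow> 'v \<Rightarrow> real) \<Rightarrow> 'v set \<Rightarrow> 'v set"
  for form A where
  simple: "a \<in> A \<Longrightarrow> a \<in> root_system form A"
| reflect: "a \<in> A \<Longrightarrow> b \<in> root_system form A \<Longrightarrow> reflection form a b \<in> root_system form A"

context symmetric_form
begin

lemma form_s_left: "form a a = 2 \<Longrightarrow> form (s a u) v = form u (s a v)"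
  using form_s_s[of a u "s a v"] by simp

lemma root_system_norm2: "A \<subseteq> norm2 \<Longrightarrow> root_system form A \<subseteq> norm2"
proof
  fix b assume "A \<subseteq> norm2" "b \<in> root_system form A"
  from this(2,1) show "b \<in> norm2" by induction auto
qed

text \<open>By \<open>s_conjugate\<close>, the reflection in \<open>s c a\<close> is the one in
  \<open>a\<close> conjugated by \<open>s c\<close>, so induction on \<open>a\<close> reduces
  everything to reflections in \<open>A\<close>.\<close>

lemma root_system_closed:
  assumes "A \<subseteq> norm2" "a \<in> root_system form A" "b \<in> root_system form A"
  shows "s a b \<in> root_system form A"
  using assms(2,1,3)
proof (induction a arbitrary: b)
  case (reflect c a)
  then have "form c c = 2" by auto
  then have "s (s c a) b = s c (s a (s c b))"
    by (simp add: s_conjugate)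
  then show ?case
    using reflect by (simp add: root_system.reflect)
qed (rule root_system.reflect)

lemma root_system_uminus:
  assumes "A \<subseteq> norm2" "a \<in> root_system form A"
  shows "- a \<in> root_system form A"
  using root_system_closed[OF assms(1) assms(2) assms(2)] root_system_norm2[OF assms(1)] assms(2)
  by auto

lemma root_system_P:
  assumes "A \<subseteq> norm2" "set xs \<subseteq> root_system form A" "b \<in> root_system form A"
  shows "P xs b \<in> root_system form A"
  using assms(2)
proof (induction xs)
  case (Cons x xs)
  then show ?case using root_system_closed[OF assms(1), of x "P xs b"] by simp
qed (simp add: assms)

text \<open>A simple reflection in the first argument moves to the second by
  \<open>form_s_left\<close>, so it suffices to treat simple \<open>a\<close>, where induction on
  \<open>b\<close> applies.\<close>

lemma root_system_form_Ints:
  assumes A: "A \<subseteq> norm2" and int: "\<And>a b. a \<in> A \<Longrightarrow> b \<in> A \<Longrightarrow> form a b \<in> \<int>"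
    and "a \<in> root_system form A" "b \<in> root_system form A"
  shows "form a b \<in> \<int>"
proof -
  have 1: "form c b \<in> \<int>" if "b \<in> root_system form A" "c \<in> A" for b c
    using that
  proof (induction arbitrary: c)
    case (reflect d b)
    then have "form d d = 2" using A by auto
    then show ?case using reflect int[of c d] by (simp add: s_eq)
  qed (rule int)
  from assms(3,4) show ?thesis
  proof (induction arbitrary: b)
    case (reflect c a)
    then have "form c c = 2" using A by auto
    then show ?case
      using reflect root_system.reflect[of c A b form] by (simp add: form_s_left)
  qed (rule 1)
qed

end

text \<open>Independence of the simple roots is encoded by dual functionals \<open>coord i\<close>
  on the whole space, which the simple roots need not span. This allows coordinates that vanish on a
  radical vector outside the span.\<close>

locale root_basis = symmetric_form form
  for form :: "'v::real_vector \<Rightarrow> 'v \<Rightarrow> real" +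
  fixes I :: "'i set" and \<alpha> :: "'i \<Rightarrow> 'v" and coord :: "'i \<Rightarrow> 'v \<Rightarrow> real"
  assumes finite_I: "finite I"
    and norm_\<alpha>: "i \<in> I \<Longrightarrow> form (\<alpha> i) (\<alpha> i) = 2"
    and simply_laced: "i \<in> I \<Longrightarrow> j \<in> I \<Longrightarrow> i \<noteq> j \<Longrightarrow> form (\<alpha> i) (\<alpha> j) = 0 \<or> form (\<alpha> i) (\<alpha> j) = -1"
    and linear_coord: "i \<in> I \<Longrightarrow> linear (coord i)"
    and coord_\<alpha>: "i \<in> I \<Longrightarrow> j \<in> I \<Longrightarrow> coord i (\<alpha> j) = (if i = j then 1 else 0)"
begin

abbreviation "roots \<equiv> root_system form (\<alpha> ` I)"
abbreviation W :: "'i list \<Rightarrow> 'v \<Rightarrow> 'v" where "W ks \<equiv> P (map \<alpha> ks)"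
definition weyl :: "('v \<Rightarrow> 'v) set" where "weyl = {W ks | ks. set ks \<subseteq> I}"
definition Pos :: "'v \<Rightarrow> bool" where "Pos v \<longleftrightarrow> (\<forall>i\<in>I. coord i v \<ge> 0)"
definition hgt :: "'v \<Rightarrow> real" where "hgt v = (\<Sum>i\<in>I. coord i v)"
definition len :: "('v \<Rightarrow> 'v) \<Rightarrow> nat" where
  "len w = (LEAST k. \<exists>ks. set ks \<subseteq> I \<and> length ks = k \<and> W ks = w)"

lemma coord_simps [simp]:
  assumes "i \<in> I"
  shows "coord i (u + v) = coord i u + coord i v" "coord i (u - v) = coord i u - coord i v"
    "coord i (c *\<^sub>R v) = c * coord i v" "coord i (- v) = - coord i v" "coord i 0 = 0"
  using linear_coord[OF assms]
  by (simp_all add: linear_add linear_diff linear_scale linear_neg linear_0)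

lemma hgt_simps [simp]:
  "hgt (u + v) = hgt u + hgt v" "hgt (u - v) = hgt u - hgt v"
  "hgt (c *\<^sub>R v) = c * hgt v" "hgt (- v) = - hgt v"
  by (simp_all add: hgt_def sum.distrib sum_subtractf sum_distrib_left sum_negf)

lemma \<alpha>_norm2: "\<alpha> ` I \<subseteq> norm2" and word_norm2: "set ks \<subseteq> I \<Longrightarrow> \<alpha> ` set ks \<subseteq> norm2"
  using norm_\<alpha> by auto

lemma roots_norm2: "b \<in> roots \<Longrightarrow> form b b = 2"
  using root_system_norm2[OF \<alpha>_norm2] by auto

lemmas roots_closed = root_system_closed[OF \<alpha>_norm2]
lemma roots_simple: "i \<in> I \<Longrightarrow> \<alpha> i \<in> roots"
  by (simp add: root_system.simple)
lemmas roots_uminus = root_system_uminus[OF \<alpha>_norm2]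

lemma roots_W: "set ks \<subseteq> I \<Longrightarrow> b \<in> roots \<Longrightarrow> W ks b \<in> roots"
  by (rule root_system_P[OF \<alpha>_norm2]) (auto intro: root_system.simple)

lemma roots_weyl: "w \<in> weyl \<Longrightarrow> b \<in> roots \<Longrightarrow> w b \<in> roots"
  by (auto simp: weyl_def roots_W)

lemma linear_weyl: "w \<in> weyl \<Longrightarrow> linear w"
  by (auto simp: weyl_def linear_P)

lemma roots_form_Ints: "a \<in> roots \<Longrightarrow> b \<in> roots \<Longrightarrow> form a b \<in> \<int>"
proof (rule root_system_form_Ints[OF \<alpha>_norm2])
  fix a b assume "a \<in> \<alpha> ` I" "b \<in> \<alpha> ` I"
  then obtain i j where "i \<in> I" "j \<in> I" "a = \<alpha> i" "b = \<alpha> j" by auto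
  then show "form a b \<in> \<int>"
    using norm_\<alpha>[of i] simply_laced[of i j] by (cases "i = j") auto
qed

lemma span_root: "b \<in> roots \<Longrightarrow> b \<in> span (\<alpha> ` I)"
proof (induction rule: root_system.induct)
  case (reflect a b)
  then show ?case
    by (auto simp: reflection_def intro!: span_diff span_scale intro: span_base)
qed (rule span_base)

lemma span_coord:
  assumes "v \<in> span (\<alpha> ` I)"
  shows "v = (\<Sum>i\<in>I. coord i v *\<^sub>R \<alpha> i)"
  using assms
proof (induction rule: span_induct_alt)
  case base
  then show ?case by simp
next
  case (step c x y)
  then obtain j where j: "j \<in> I" "x = \<alpha> j" by auto
  have "(\<Sum>i\<in>I. coord i (\<alpha> j) *\<^sub>R \<alpha> i) = (\<Sum>i\<in>I. if i = j then \<alpha> j else 0)"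
    using j by (intro sum.cong) (auto simp: coord_\<alpha>)
  also have "\<dots> = \<alpha> j" using j finite_I by simp
  finally have *: "(\<Sum>i\<in>I. coord i (\<alpha> j) *\<^sub>R \<alpha> i) = \<alpha> j" .
  have "(\<Sum>i\<in>I. coord i (c *\<^sub>R x + y) *\<^sub>R \<alpha> i) =
      c *\<^sub>R (\<Sum>i\<in>I. coord i (\<alpha> j) *\<^sub>R \<alpha> i) + (\<Sum>i\<in>I. coord i y *\<^sub>R \<alpha> i)"
    by (simp add: j(2) algebra_simps sum.distrib scaleR_sum_right)
  then show ?case using * step(2) j(2) by simp
qed

lemma span_coord_zero: "v \<in> span (\<alpha> ` I) \<Longrightarrow> (\<And>i. i \<in> I \<Longrightarrow> coord i v = 0) \<Longrightarrow> v = 0"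
  using span_coord[of v] by simp

lemma root_nonzero: "b \<in> roots \<Longrightarrow> b \<noteq> 0"
  using roots_norm2[of b] by auto

lemma Pos_hgt:
  assumes "b \<in> roots" "Pos b"
  shows "hgt b > 0"
proof -
  obtain i where "i \<in> I" "coord i b \<noteq> 0"
    using span_coord_zero[OF span_root] root_nonzero assms by blast
  with assms(2) show ?thesis
    unfolding hgt_def by (intro sum_pos2[of I i]) (auto simp: Pos_def finite_I order_less_le)
qed

lemma Pos_add: "Pos u \<Longrightarrow> Pos v \<Longrightarrow> Pos (u + v)"
  and Pos_scale: "c \<ge> 0 \<Longrightarrow> Pos u \<Longrightarrow> Pos (c *\<^sub>R u)"
  by (auto simp: Pos_def)

lemma not_Pos_both: "b \<in> roots \<Longrightarrow> Pos b \<Longrightarrow> Pos (- b) \<Longrightarrow> False"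
  using Pos_hgt[of b] Pos_hgt[of "- b"] roots_uminus by fastforce

lemma root_eq_W: "b \<in> roots \<Longrightarrow> \<exists>ks i. set ks \<subseteq> I \<and> i \<in> I \<and> b = W ks (\<alpha> i)"
proof (induction rule: root_system.induct)
  case (simple a)
  then obtain i where "i \<in> I" "a = \<alpha> i" by blast
  then show ?case by (intro exI[of _ "[]"] exI[of _ i]) simp
next
  case (reflect a b)
  then obtain ks i j where "set ks \<subseteq> I" "i \<in> I" "b = W ks (\<alpha> i)" "j \<in> I" "a = \<alpha> j" by blast
  then show ?case by (intro exI[of _ "j # ks"] exI[of _ i]) simp
qed

section \<open>Word length, signs of roots and the exchange condition\<close>

lemma len_le: "set ks \<subseteq> I \<Longrightarrow> len (W ks) \<le> length ks"
  unfolding len_def by (rule Least_le) auto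

lemma len_attained:
  assumes "w \<in> weyl"
  obtains "ks" where "set ks \<subseteq> I" "length ks = len w" "W ks = w"
proof -
  have "\<exists>k ks. set ks \<subseteq> I \<and> length ks = k \<and> W ks = w"
    using assms by (auto simp: weyl_def)
  then have "\<exists>ks. set ks \<subseteq> I \<and> length ks = len w \<and> W ks = w"
    unfolding len_def by (rule LeastI_ex)
  then show ?thesis using that by blast
qed

lemma weyl_comp: "v \<in> weyl \<Longrightarrow> w \<in> weyl \<Longrightarrow> v \<circ> w \<in> weyl"
proof -
  assume "v \<in> weyl" "w \<in> weyl"
  then obtain ks js where "set ks \<subseteq> I" "set js \<subseteq> I" "v = W ks" "w = W js"
    by (auto simp: weyl_def)
  then have "v \<circ> w = W (ks @ js)" "set (ks @ js) \<subseteq> I" by auto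
  then show ?thesis unfolding weyl_def by blast
qed

lemma weyl_W: "set ks \<subseteq> I \<Longrightarrow> W ks \<in> weyl"
  by (auto simp: weyl_def)

lemma weyl_id: "id \<in> weyl"
  using weyl_W[of "[]"] by simp

lemma weyl_s_simple: "i \<in> I \<Longrightarrow> s (\<alpha> i) \<in> weyl"
  using weyl_W[of "[i]"] by simp

lemma weyl_s:
  assumes "b \<in> roots"
  shows "s b \<in> weyl"
proof -
  obtain ks i where ks: "set ks \<subseteq> I" "i \<in> I" and b: "b = W ks (\<alpha> i)"
    using root_eq_W[OF assms] by blast
  have norm: "set (map \<alpha> ks) \<subseteq> norm2" using word_norm2[OF ks(1)] by simp
  have "s b = W ks \<circ> s (\<alpha> i) \<circ> W (rev ks)"
    using s_P_eq[OF norm, of "\<alpha> i"] by (simp only: b rev_map)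
  then have "s b = W (ks @ i # rev ks)" "set (ks @ i # rev ks) \<subseteq> I"
    using ks by (simp_all add: comp_assoc)
  then show ?thesis unfolding weyl_def by blast
qed

lemma len_id: "len id = 0"
  using len_le[of "[]"] by simp

lemma len_0: "w \<in> weyl \<Longrightarrow> len w = 0 \<Longrightarrow> w = id"
  by (metis len_attained length_0_conv list.simps(8) reflection_prod_Nil)

lemma len_comp_simple:
  assumes "w \<in> weyl" "i \<in> I"
  shows "len (w \<circ> s (\<alpha> i)) \<le> len w + 1"
proof -
  obtain "ks" where "set ks \<subseteq> I" "length ks = len w" "W ks = w"
    using len_attained[OF assms(1)] .
  then show ?thesis using len_le[of "ks @ [i]"] assms(2) by simp
qed

lemma len_descent:
  assumes "w \<in> weyl" "len w > 0"
  obtains i where "i \<in> I" "len (w \<circ> s (\<alpha> i)) < len w"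
proof -
  obtain "ks" where ks: "set ks \<subseteq> I" "length ks = len w" "W ks = w"
    using len_attained[OF assms(1)] .
  then obtain js i where js: "ks = js @ [i]" using assms(2) by (cases "ks" rule: rev_cases) auto
  then have "w \<circ> s (\<alpha> i) = W js"
    using ks norm_\<alpha>[of i] by (auto simp: comp_assoc)
  then have "len (w \<circ> s (\<alpha> i)) < len w"
    using len_le[of js] ks js by simp
  then show ?thesis using that[of i] ks js by simp
qed

text \<open>Tits' argument: the rank two parabolic subgroups are of type \<open>A\<^sub>1 \<times> A\<^sub>1\<close> or \<open>A\<^sub>2\<close>.\<close>

lemma Pos_if_len_le:
  assumes "w \<in> weyl" "i \<in> I" "len w \<le> len (w \<circ> s (\<alpha> i))"
  shows "Pos (w (\<alpha> i))"
  using assms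
proof (induction "len w" arbitrary: w i rule: less_induct)
  case less
  show ?case
  proof (cases "len w = 0")
    case True
    then have "w = id" using len_0 less.prems by blast
    then show ?thesis using less.prems(2) by (simp add: Pos_def coord_\<alpha>)
  next
    case False
    \<comment> \<open>\<open>j\<close> ends a shortest word for \<open>w\<close>; the induction
      hypothesis is applied to what is left of it.\<close>
    then obtain j where j: "j \<in> I" "len (w \<circ> s (\<alpha> j)) < len w"
      using len_descent[OF less.prems(1)] by blast
    define v where "v = w \<circ> s (\<alpha> j)"
    have v: "v \<in> weyl" "len v < len w"
      using j less.prems(1) by (auto simp: v_def weyl_comp weyl_s_simple)
    have lin: "linear v" by (rule linear_weyl[OF v(1)])
    have nj: "form (\<alpha> j) (\<alpha> j) = 2" and ni: "form (\<alpha> i) (\<alpha> i) = 2"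
      using norm_\<alpha> j less.prems by auto
    have w: "w = v \<circ> s (\<alpha> j)" using nj by (simp add: v_def comp_assoc)
    have "i \<noteq> j" using j less.prems(3) by auto
    then consider "form (\<alpha> j) (\<alpha> i) = 0" | "form (\<alpha> j) (\<alpha> i) = -1"
      using simply_laced[of j i] j less.prems by auto
    then show ?thesis
    proof cases
      case 1
      have comm: "s (\<alpha> j) \<circ> s (\<alpha> i) = s (\<alpha> i) \<circ> s (\<alpha> j)"
        using 1 sym[of "\<alpha> i" "\<alpha> j"] nj ni by (simp add: fun_eq_iff s_eq algebra_simps)
      \<comment> \<open>Otherwise \<open>w \<circ> s (\<alpha> i)\<close>, with its last two
        commuting letters swapped, would be at most as long as \<open>v\<close>, hence shorter than
        \<open>w\<close>.\<close>
      have "len v \<le> len (v \<circ> s (\<alpha> i))"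
      proof (rule ccontr)
        assume "\<not> ?thesis"
        then have "len (v \<circ> s (\<alpha> i) \<circ> s (\<alpha> j)) \<le> len v"
          using len_comp_simple[of "v \<circ> s (\<alpha> i)" j] v j less.prems
          by (simp add: weyl_comp weyl_s_simple)
        moreover have "w \<circ> s (\<alpha> i) = v \<circ> s (\<alpha> i) \<circ> s (\<alpha> j)"
          by (simp add: w comp_assoc comm)
        ultimately show False using less.prems(3) v by simp
      qed
      then have "Pos (v (\<alpha> i))" using less.hyps v less.prems by blast
      then show ?thesis using 1 nj by (simp add: w s_eq)
    next
      case 2
      have wi: "w (\<alpha> i) = v (\<alpha> i) + v (\<alpha> j)"
        using 2 nj by (simp add: w s_eq linear_add[OF lin])
      have "len v \<le> len (v \<circ> s (\<alpha> j))" using v by (simp add: w)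
      then have pj: "Pos (v (\<alpha> j))" using less.hyps v j by blast
      show ?thesis
      proof (cases "len v \<le> len (v \<circ> s (\<alpha> i))")
        case True
        then have "Pos (v (\<alpha> i))" using less.hyps v less.prems by blast
        then show ?thesis using pj by (simp add: wi Pos_add)
      next
        case False
        \<comment> \<open>Now \<open>i\<close> is stripped as well. With
          \<open>w = u \<circ> s (\<alpha> i) \<circ> s (\<alpha> j)\<close> the root
          \<open>w (\<alpha> i)\<close> becomes \<open>u (\<alpha> j)\<close>.\<close>
        define u where "u = v \<circ> s (\<alpha> i)"
        have u: "u \<in> weyl" "len u < len v"
          using False v less.prems by (auto simp: u_def weyl_comp weyl_s_simple)
        have vu: "v = u \<circ> s (\<alpha> i)" using ni by (simp add: u_def comp_assoc)
        have braid: "s (\<alpha> i) \<circ> (s (\<alpha> j) \<circ> s (\<alpha> i)) = s (\<alpha> j) \<circ> (s (\<alpha> i) \<circ> s (\<alpha> j))"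
          using 2 sym[of "\<alpha> i" "\<alpha> j"] nj ni by (simp add: fun_eq_iff s_eq algebra_simps)
        have uj: "u \<circ> s (\<alpha> j) \<in> weyl" "u \<circ> s (\<alpha> j) \<circ> s (\<alpha> i) \<in> weyl"
          using u j less.prems by (auto simp: weyl_comp weyl_s_simple)
        \<comment> \<open>Otherwise the braid relation turns \<open>w \<circ> s (\<alpha> i)\<close>
          into a product of length at most \<open>len u + 1\<close>, which is less than
          \<open>len w\<close>.\<close>
        have "len u \<le> len (u \<circ> s (\<alpha> j))"
        proof (rule ccontr)
          assume "\<not> ?thesis"
          then have "len (u \<circ> s (\<alpha> j) \<circ> s (\<alpha> i) \<circ> s (\<alpha> j)) \<le> len u + 1"
            using len_comp_simple[OF uj(1) less.prems(2)] len_comp_simple[OF uj(2) j(1)] by simp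
          moreover have "w \<circ> s (\<alpha> i) = u \<circ> s (\<alpha> j) \<circ> s (\<alpha> i) \<circ> s (\<alpha> j)"
            by (simp add: w vu comp_assoc braid)
          ultimately show False using less.prems(3) v u by simp
        qed
        moreover have "len u < len w" using u v by simp
        ultimately have "Pos (u (\<alpha> j))" using less.hyps u j by blast
        moreover have "w (\<alpha> i) = u (\<alpha> j)"
          using 2 sym[of "\<alpha> i" "\<alpha> j"] nj ni by (simp add: w vu s_eq)
        ultimately show ?thesis by simp
      qed
    qed
  qed
qed

text \<open>Write \<open>b = w (\<alpha> i)\<close>. One of \<open>w\<close> and
  \<open>w \<circ> s (\<alpha> i)\<close> does not get shorter by the letter \<open>i\<close>, and
  the second one sends \<open>\<alpha> i\<close> to \<open>- b\<close>.\<close>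

lemma root_Pos_or_neg:
  assumes "b \<in> roots"
  shows "Pos b \<or> Pos (- b)"
proof -
  obtain ks i where ks: "set ks \<subseteq> I" and i: "i \<in> I" and b: "b = W ks (\<alpha> i)"
    using root_eq_W[OF assms] by blast
  then obtain w where w: "w \<in> weyl" "b = w (\<alpha> i)"
    using b weyl_W by blast
  have n: "form (\<alpha> i) (\<alpha> i) = 2" by (rule norm_\<alpha>[OF i])
  show ?thesis
  proof (cases "len w \<le> len (w \<circ> s (\<alpha> i))")
    case True
    then show ?thesis using Pos_if_len_le[OF w(1) i] w(2) by simp
  next
    case False
    moreover have "w \<circ> s (\<alpha> i) \<circ> s (\<alpha> i) = w" using n by (simp add: comp_assoc)
    ultimately have "Pos ((w \<circ> s (\<alpha> i)) (\<alpha> i))"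
      by (intro Pos_if_len_le[OF weyl_comp[OF w(1) weyl_s_simple[OF i]] i]) simp
    then show ?thesis using n linear_neg[OF linear_weyl[OF w(1)]] by (simp add: w(2))
  qed
qed

text \<open>The value \<open>form b b = 2\<close> leaves \<open>\<alpha> i\<close> as the only
  positive root proportional to \<open>\<alpha> i\<close>, so \<open>b\<close> has another positive
  coordinate. It survives \<open>s (\<alpha> i)\<close>, and one positive coordinate makes a root
  positive.\<close>

lemma Pos_simple_reflection:
  assumes b: "b \<in> roots" "Pos b" and i: "i \<in> I" and ne: "b \<noteq> \<alpha> i"
  shows "Pos (s (\<alpha> i) b)"
proof -
  have n: "form (\<alpha> i) (\<alpha> i) = 2" by (rule norm_\<alpha>[OF i])
  have "\<exists>j\<in>I. j \<noteq> i \<and> coord j b \<noteq> 0"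
  proof (rule ccontr)
    assume *: "\<not> ?thesis"
    have "b = (\<Sum>j\<in>I. coord j b *\<^sub>R \<alpha> j)" by (rule span_coord[OF span_root[OF b(1)]])
    also have "\<dots> = (\<Sum>j\<in>I. if j = i then coord i b *\<^sub>R \<alpha> i else 0)"
      using * by (intro sum.cong) auto
    also have "\<dots> = coord i b *\<^sub>R \<alpha> i" using finite_I i by simp
    finally have eq: "b = coord i b *\<^sub>R \<alpha> i" .
    have "form b b = coord i b * coord i b * 2"
      by (subst eq, subst (2) eq) (simp add: n)
    then have "coord i b * coord i b = 1" using roots_norm2[OF b(1)] by simp
    then have "coord i b = 1" using b(2) i by (auto simp: Pos_def square_eq_1_iff)
    then show False using eq ne by simp
  qed
  then obtain j where j: "j \<in> I" "j \<noteq> i" "coord j b \<noteq> 0" by blast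
  then have "coord j (s (\<alpha> i) b) > 0"
    using b(2) i by (simp add: s_eq n coord_\<alpha> Pos_def order_less_le)
  then have "\<not> Pos (- s (\<alpha> i) b)" using j by (force simp: Pos_def)
  then show ?thesis using root_Pos_or_neg roots_closed[OF roots_simple] b i by blast
qed

text \<open>The letters act on \<open>b\<close> from right to left. At a letter where the sign turns
  from positive to negative, the root reached so far must be the simple root of that letter by
  \<open>Pos_simple_reflection\<close>.\<close>

lemma exchange:
  assumes "set ks \<subseteq> I" "b \<in> roots" "Pos b" "Pos (- W ks b)"
  shows "\<exists>as i bs. ks = as @ i # bs \<and> W bs b = \<alpha> i"
  using assms(1,4)
proof (induction "ks")
  case Nil
  then show ?case using not_Pos_both assms by simp
next
  case (Cons i "ks")
  show ?case
  proof (cases "Pos (- W ks b)")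
    case True
    then obtain as j bs where "ks = as @ j # bs" "W bs b = \<alpha> j" using Cons by auto
    then show ?thesis by (intro exI[of _ "i # as"]) auto
  next
    case False
    have r: "W ks b \<in> roots" using Cons.prems assms roots_W by simp
    then have "Pos (W ks b)" using False root_Pos_or_neg by blast
    moreover have "s (\<alpha> i) (W ks b) \<in> roots"
      using r Cons.prems roots_closed[OF roots_simple] by simp
    then have "\<not> Pos (s (\<alpha> i) (W ks b))" using Cons.prems not_Pos_both by auto
    ultimately have "W ks b = \<alpha> i" using Pos_simple_reflection r Cons.prems by auto
    then show ?thesis by (intro exI[of _ "[]"]) auto
  qed
qed

text \<open>\<open>W bs\<close> conjugates \<open>s b\<close> into the reflection of the letter
  \<open>i\<close>, so the two cancel. Together with \<open>exchange\<close> this is the strong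
  exchange condition.\<close>

lemma exchange_delete:
  assumes "set (as @ i # bs) \<subseteq> I" "W bs b = \<alpha> i"
  shows "W (as @ i # bs) \<circ> s b = W (as @ bs)"
proof -
  have "s (\<alpha> i) \<circ> W bs = W bs \<circ> s b"
    using s_P_conjugate[of "map \<alpha> bs" b] assms word_norm2[of bs] by simp
  then have "W (as @ i # bs) \<circ> s b = W as \<circ> (W bs \<circ> (s b \<circ> s b))"
    by (simp add: comp_assoc)
  moreover have "form b b = 2"
    using form_P[of "map \<alpha> bs" b b] assms word_norm2[of bs] norm_\<alpha>[of i] by simp
  ultimately show ?thesis by simp
qed

lemma len_less:
  assumes "w \<in> weyl" "b \<in> roots" "Pos b" "Pos (- w b)"
  shows "len (w \<circ> s b) < len w"
proof -
  obtain "ks" where ks: "set ks \<subseteq> I" "length ks = len w" "W ks = w"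
    using len_attained[OF assms(1)] .
  then obtain as i bs where "ks = as @ i # bs" "W bs b = \<alpha> i" using exchange assms by blast
  then show ?thesis
    using exchange_delete[of as i bs b] ks len_le[of "as @ bs"] by simp
qed

lemma len_less_neg:
  assumes "w \<in> weyl" "b \<in> roots" "Pos (- b)" "Pos (w b)"
  shows "len (w \<circ> s b) < len w"
  using len_less[of w "- b"] assms roots_uminus linear_neg[OF linear_weyl[OF assms(1)]] by simp

lemma len_greater:
  assumes "w \<in> weyl" "b \<in> roots" "Pos b" "Pos (w b)"
  shows "len w < len (w \<circ> s b)"
proof -
  have n: "form b b = 2" by (rule roots_norm2[OF assms(2)])
  have "len (w \<circ> s b \<circ> s b) < len (w \<circ> s b)"
    by (rule len_less[OF weyl_comp[OF assms(1) weyl_s]])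
      (use assms n linear_neg[OF linear_weyl[OF assms(1)], of b] in simp_all)
  then show ?thesis using n by (simp add: comp_assoc)
qed

lemma len_less_iff:
  assumes "w \<in> weyl" "b \<in> roots" "Pos b"
  shows "len (w \<circ> s b) < len w \<longleftrightarrow> Pos (- w b)"
proof
  assume "len (w \<circ> s b) < len w"
  show "Pos (- w b)"
  proof (rule ccontr)
    assume "\<not> ?thesis"
    then have "Pos (w b)" using root_Pos_or_neg roots_weyl assms by blast
    then show False using len_greater[OF assms] \<open>len (w \<circ> s b) < len w\<close> by simp
  qed
qed (use len_less assms in blast)

lemma len_neq:
  assumes "w \<in> weyl" "b \<in> roots"
  shows "len (w \<circ> s b) \<noteq> len w"
proof -
  have *: "len (w \<circ> s b) \<noteq> len w" if b: "b \<in> roots" "Pos b" for b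
  proof (cases "Pos (- w b)")
    case True
    then show ?thesis using len_less[OF assms(1) that] by simp
  next
    case False
    then have "Pos (w b)" using root_Pos_or_neg roots_weyl assms(1) b by blast
    then show ?thesis using len_greater[OF assms(1) b] by simp
  qed
  show ?thesis
    using *[of b] *[of "- b"] root_Pos_or_neg[OF assms(2)] roots_uminus assms(2) by auto
qed

text \<open>By \<open>exchange\<close>, every inversion comes from a position in a word for
  \<open>w\<close>: carry the simple root of that letter back through the letters to its
  right.\<close>

lemma finite_inversions:
  assumes "w \<in> weyl"
  shows "finite {b \<in> roots. Pos b \<and> Pos (- w b)}"
proof -
  obtain "ks" where ks: "set ks \<subseteq> I" "W ks = w" using assms by (auto simp: weyl_def)
  have "{b \<in> roots. Pos b \<and> Pos (- w b)} \<subseteq>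
      (\<lambda>k. W (rev (drop (Suc k) ks)) (\<alpha> (ks ! k))) ` {..<length ks}"
  proof
    fix b assume "b \<in> {b \<in> roots. Pos b \<and> Pos (- w b)}"
    then obtain as i bs where *: "ks = as @ i # bs" "W bs b = \<alpha> i" using exchange ks by blast
    then have "b = W (rev bs) (\<alpha> i)"
      using P_rev(1)[of "map \<alpha> bs" b] ks word_norm2[of bs] by (simp add: rev_map)
    then show "b \<in> (\<lambda>k. W (rev (drop (Suc k) ks)) (\<alpha> (ks ! k))) ` {..<length ks}"
      using * by (intro image_eqI[of _ _ "length as"]) auto
  qed
  then show ?thesis by (rule finite_subset) simp
qed

end

section \<open>Factorizations of products of distinct simple reflections\<close>

context root_basis
begin

section \<open>Lowering a peak inside a dihedral reflection subgroup\<close>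

lemmas [trans] = hurwitz_eq.trans

text \<open>Roots are proportional only up to sign, as both have square length 2. The functional
  serves to see that a sequence of roots never repeats.\<close>

lemma root_functional:
  assumes "b \<in> roots" "c \<in> roots" "b \<noteq> c" "b \<noteq> - c"
  obtains L :: "'v \<Rightarrow> real" where "linear L" "L c = 0" "L b = 1"
proof -
  have "b \<notin> span {c}"
  proof
    assume "b \<in> span {c}"
    then obtain t where t: "b = t *\<^sub>R c" by (auto simp: span_singleton)
    have "form b b = 2" "form c c = 2" using assms roots_norm2 by auto
    then have "t * t = 1" by (simp add: t)
    then have "t = 1 \<or> t = -1" by (simp add: square_eq_1_iff)
    then show False using t assms by auto
  qed
  then have "independent {b, c}"
    using root_nonzero[OF assms(2)] assms(3) by (auto simp: independent_insert)
  then obtain L where "linear L" "\<forall>x\<in>{b, c}. L x = (if x = b then 1 else 0 :: real)"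
    using linear_independent_extend[of "{b, c}" "\<lambda>x. if x = b then 1 else 0 :: real"] by blast
  then show ?thesis using that assms(3) by auto
qed

text \<open>The \<open>e k\<close> are, up to sign, consecutive roots of the infinite dihedral group generated by \<open>s b\<close> and
  \<open>s c\<close>, so \<open>s c \<circ> s b = s (e k) \<circ> s (e (k + 1))\<close> for all \<open>k\<close>. As \<open>y\<close> sends all of them to negative roots
  but has finitely many inversions, the sequence eventually leaves the positive roots; there the
  product is seen to decrease the length.\<close>

lemma peak_infinite:
  assumes y: "y \<in> weyl" and b: "b \<in> roots" "Pos b" "Pos (- y b)"
    and c: "c \<in> roots" "Pos c" "Pos (- y c)"
    and ne: "b \<noteq> c" and a2: "form b c \<ge> 2" and le: "hgt (y b) \<le> hgt (y c)"
  shows "len (y \<circ> s c \<circ> s b) < len y"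
proof -
  define a where "a = form b c"
  \<comment> \<open>\<open>st k\<close> is the pair of \<open>e k\<close> and
    \<open>e (k + 1)\<close>, since the recurrence has order two. It says that
    \<open>e (k + 2) = - s (e (k + 1)) (e k)\<close>.\<close>
  define st where "st k = ((\<lambda>(u, v). (v, a *\<^sub>R v - u)) ^^ k) (c, b)" for k
  define e where "e k = fst (st k)" for k
  have e0: "e 0 = c" and e1: "e (Suc 0) = b" and eS: "e (Suc (Suc k)) = a *\<^sub>R e (Suc k) - e k" for k
    by (simp_all add: e_def st_def split_beta)
  have lin: "linear y" by (rule linear_weyl[OF y])
  have a: "a \<ge> 2" using a2 by (simp add: a_def)
  have e_prop: "e k \<in> roots \<and> e (Suc k) \<in> roots \<and> form (e k) (e (Suc k)) = a \<and>
      s (e k) \<circ> s (e (Suc k)) = s c \<circ> s b" for k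
  proof (induction k)
    case 0
    then show ?case using b c by (simp add: e0 e1 a_def sym)
  next
    case (Suc k)
    then have n: "form (e (Suc k)) (e (Suc k)) = 2" using roots_norm2 by blast
    have neg: "e (Suc (Suc k)) = - s (e (Suc k)) (e k)"
      using Suc sym[of "e k" "e (Suc k)"] by (simp add: eS s_eq n)
    have "s (e (Suc k)) \<circ> s (e (Suc (Suc k))) = s (e k) \<circ> s (e (Suc k))"
      by (simp add: neg s_conjugate n comp_assoc)
    moreover have "form (e (Suc k)) (e (Suc (Suc k))) = a"
      using Suc sym[of "e k" "e (Suc k)"] by (simp add: eS n)
    ultimately show ?case
      using Suc roots_uminus roots_closed by (simp add: neg)
  qed
  \<comment> \<open>As \<open>a \<ge> 2\<close>, the increments of \<open>H\<close> never shrink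
    while \<open>H\<close> is positive; the hypothesis \<open>le\<close> makes the first one
    nonnegative.\<close>
  define H where "H k = - hgt (y (e k))" for k
  have HS: "H (Suc (Suc k)) = a * H (Suc k) - H k" for k
    by (simp add: H_def eS linear_diff[OF lin] linear_scale[OF lin])
  have hgt_neg: "hgt (- y b) > 0" "hgt (- y c) > 0"
    using Pos_hgt[OF roots_uminus[OF roots_weyl[OF y b(1)]] b(3)]
      Pos_hgt[OF roots_uminus[OF roots_weyl[OF y c(1)]] c(3)] .
  have H_pos: "0 < H k \<and> H k \<le> H (Suc k)" for k
  proof (induction k)
    case 0
    then show ?case using hgt_neg le by (simp add: H_def e0 e1)
  next
    case (Suc k)
    moreover have "2 * H (Suc k) \<le> a * H (Suc k)"
      using a Suc by (intro mult_right_mono) auto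
    ultimately show ?case unfolding HS by linarith
  qed
  have e_neg: "Pos (- y (e k))" for k
    using root_Pos_or_neg[of "y (e k)"] Pos_hgt[of "y (e k)"] roots_weyl[OF y] e_prop[of k] H_pos[of k]
    by (force simp: H_def)
  have "\<exists>k. \<not> Pos (e k)"
  proof (rule ccontr)
    assume "\<not> ?thesis"
    then have "range e \<subseteq> {b \<in> roots. Pos b \<and> Pos (- y b)}"
      using e_prop e_neg by auto
    then have fin: "finite (range e)"
      using finite_inversions[OF y] finite_subset by blast
    have "b \<noteq> - c"
      using not_Pos_both[OF c(1,2)] b(2) by auto
    then obtain L where L: "linear L" "L c = 0" "L b = (1::real)"
      using root_functional[OF b(1) c(1) ne] by blast
    have "0 \<le> L (e k) \<and> L (e k) < L (e (Suc k))" for k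
    proof (induction k)
      case 0
      then show ?case by (simp add: e0 e1 L)
    next
      case (Suc k)
      moreover have "2 * L (e (Suc k)) \<le> a * L (e (Suc k))"
        using a Suc by (intro mult_right_mono) auto
      moreover have "L (e (Suc (Suc k))) = a * L (e (Suc k)) - L (e k)"
        by (simp add: eS linear_diff[OF L(1)] linear_scale[OF L(1)])
      ultimately show ?case by linarith
    qed
    then have "strict_mono (\<lambda>k. L (e k))"
      by (simp add: strict_mono_Suc_iff)
    then have "inj (\<lambda>k. L (e k))"
      by (rule strict_mono_imp_inj_on)
    then have "inj e" by (auto simp: inj_def)
    then show False using fin finite_imageD infinite_UNIV_nat by blast
  qed
  \<comment> \<open>\<open>e K\<close> is the first root that is not positive;
    \<open>K \<ge> 2\<close> as \<open>e 0\<close> and \<open>e 1\<close> are \<open>c\<close> and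
    \<open>b\<close>. With \<open>K = k + 2\<close>, the reflection in \<open>e (k + 1)\<close>
    descends from \<open>y\<close>, and the one in \<open>e K\<close> descends again.\<close>
  define K where "K = (LEAST k. \<not> Pos (e k))"
  have K: "\<not> Pos (e K)" "\<And>k. k < K \<Longrightarrow> Pos (e k)"
    unfolding K_def using LeastI_ex[OF \<open>\<exists>k. \<not> Pos (e k)\<close>] not_less_Least by blast+
  have "K \<noteq> 0" "K \<noteq> Suc 0" using K(1) b c e0 e1 by metis+
  then obtain k where k: "K = Suc (Suc k)" by (metis not0_implies_Suc)
  have r: "e k \<in> roots" "e (Suc k) \<in> roots" "e (Suc (Suc k)) \<in> roots" using e_prop by auto
  let ?w = "y \<circ> s (e (Suc k))"
  have n: "form (e (Suc k)) (e (Suc k)) = 2" using r roots_norm2 by blast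
  have "s (e (Suc k)) (e (Suc (Suc k))) = - e k"
    using e_prop[of "Suc k"] by (simp add: s_eq n, simp add: eS)
  then have "Pos (?w (e (Suc (Suc k))))"
    using e_neg[of k] by (simp add: linear_neg[OF lin])
  moreover have "Pos (- e (Suc (Suc k)))"
    using K(1) root_Pos_or_neg r k by auto
  ultimately have "len (?w \<circ> s (e (Suc (Suc k)))) < len ?w"
    using r y by (intro len_less_neg) (auto intro: weyl_comp weyl_s)
  moreover have "len ?w < len y"
    using len_less[OF y r(2) K(2) e_neg] k by simp
  moreover have "?w \<circ> s (e (Suc (Suc k))) = y \<circ> s c \<circ> s b"
    using e_prop[of "Suc k"] by (simp add: comp_assoc)
  ultimately show ?thesis by simp
qed

text \<open>In type A2 the root \<open>b\<close> is the sum of \<open>c\<close> and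
  \<open>b - c\<close>, and \<open>s b \<circ> s c\<close> equals
  \<open>s (b - c) \<circ> s b\<close>. According to the sign of \<open>y (b - c)\<close>, one of
  the two words descends from \<open>y\<close> at both steps.\<close>

lemma peak_one:
  assumes y: "y \<in> weyl" and b: "b \<in> roots" "Pos b" "Pos (- y b)"
    and c: "c \<in> roots" "Pos c" "Pos (- y c)"
    and a: "form b c = 1" and pos: "Pos (b - c)"
  shows "len (y \<circ> s b \<circ> s c) < len y"
proof -
  have lin: "linear y" by (rule linear_weyl[OF y])
  have n: "form b b = 2" "form c c = 2" using b c roots_norm2 by auto
  have bc: "s b c = - (b - c)" using a n by (simp add: s_eq)
  have r: "b - c \<in> roots"
    using roots_uminus[OF roots_closed[OF b(1) c(1)]] by (simp add: bc)
  have "s (b - c) = s b \<circ> s c \<circ> s b"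
    using s_conjugate[OF n(1), of c] by (simp only: bc s_uminus)
  then have eq: "y \<circ> s (b - c) \<circ> s b = y \<circ> s b \<circ> s c"
    using n by (simp add: comp_assoc)
  show ?thesis
  proof (cases "Pos (- y (b - c))")
    case True
    have "s (b - c) b = c"
      using roots_norm2[OF r] a n sym[of b c] by (simp add: s_eq)
    then have "Pos (- (y \<circ> s (b - c)) b)" using c by simp
    then have "len (y \<circ> s (b - c) \<circ> s b) < len (y \<circ> s (b - c))"
      by (rule len_less[OF weyl_comp[OF y weyl_s[OF r]] b(1,2)])
    also have "\<dots> < len y" by (rule len_less[OF y r pos True])
    finally show ?thesis by (simp only: eq)
  next
    case False
    then have "Pos (y (b - c))" using root_Pos_or_neg[OF roots_weyl[OF y r]] by simp
    then have "Pos (- (y \<circ> s b) c)"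
      using bc linear_neg[OF lin, of "b - c"] by simp
    then have "len (y \<circ> s b \<circ> s c) < len (y \<circ> s b)"
      by (rule len_less[OF weyl_comp[OF y weyl_s[OF b(1)]] c(1,2)])
    also have "\<dots> < len y" by (rule len_less[OF y b])
    finally show ?thesis .
  qed
qed

text \<open>The integer \<open>form b c\<close> decides the rank two situation. If it is at most 0,
  then \<open>s c b\<close> is a nonnegative combination of \<open>b\<close> and \<open>c\<close>,
  so \<open>y \<circ> s c\<close> still makes \<open>b\<close> negative; the value 1 is type A2, and
  larger values give an infinite dihedral group.\<close>

lemma peak_Pos:
  assumes y: "y \<in> weyl" and b: "b \<in> roots" "Pos b" "Pos (- y b)"
    and c: "c \<in> roots" "Pos c" "Pos (- y c)" and ne: "b \<noteq> c"
  shows "len (y \<circ> s b \<circ> s c) < len y \<or> len (y \<circ> s c \<circ> s b) < len y"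
proof -
  obtain m :: int where m: "form b c = of_int m"
    using roots_form_Ints[OF b(1) c(1)] Ints_cases by metis
  have cm: "form c b = of_int m" using m sym[of c b] by simp
  have n: "form b b = 2" "form c c = 2" using b c roots_norm2 by auto
  have lin: "linear y" by (rule linear_weyl[OF y])
  consider "m \<le> 0" | "m = 1" | "m \<ge> 2" by linarith
  then show ?thesis
  proof cases
    case 1
    have "- (y \<circ> s c) b = - y b + (- of_int m) *\<^sub>R (- y c)"
      using n cm by (simp add: s_eq linear_diff[OF lin] linear_scale[OF lin])
    moreover have "Pos \<dots>" using 1 b c by (intro Pos_add Pos_scale) auto
    ultimately have "len (y \<circ> s c \<circ> s b) < len (y \<circ> s c)"
      using len_less[OF weyl_comp[OF y weyl_s[OF c(1)]] b(1,2)] by simp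
    also have "\<dots> < len y" by (rule len_less[OF y c])
    finally show ?thesis by simp
  next
    case 2
    have "- s b c \<in> roots" using roots_uminus[OF roots_closed[OF b(1) c(1)]] .
    then have "b - c \<in> roots" using n m 2 by (simp add: s_eq)
    then have "Pos (b - c) \<or> Pos (c - b)" using root_Pos_or_neg by fastforce
    then show ?thesis
      using peak_one[OF y b c] peak_one[OF y c b] m cm 2 by auto
  next
    case 3
    then show ?thesis
      using peak_infinite[OF y b c ne] peak_infinite[OF y c b ne[symmetric]] m cm
      by (cases "hgt (y b) \<le> hgt (y c)") auto
  qed
qed

text \<open>On a path from \<open>y \<circ> s b\<close> over \<open>y\<close> to
  \<open>y \<circ> s c\<close>, the two products are the middle vertices that the two Hurwitz moves
  put in place of \<open>y\<close>.\<close>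

lemma peak:
  assumes y: "y \<in> weyl" and b: "b \<in> roots" "len (y \<circ> s b) < len y"
    and c: "c \<in> roots" "len (y \<circ> s c) < len y" and ne: "b \<noteq> c" "b \<noteq> - c"
  shows "len (y \<circ> s b \<circ> s c) < len y \<or> len (y \<circ> s c \<circ> s b) < len y"
proof -
  have *: "\<exists>d. d \<in> roots \<and> Pos d \<and> Pos (- y d) \<and> (d = b \<or> d = - b)"
    if "b \<in> roots" "len (y \<circ> s b) < len y" for b
    using root_Pos_or_neg[OF that(1)] len_less_iff[OF y, of b] len_less_iff[OF y, of "- b"]
      roots_uminus that by auto
  obtain b' where b': "b' \<in> roots" "Pos b'" "Pos (- y b')" "b' = b \<or> b' = - b"
    using *[OF b] by blast
  obtain c' where c': "c' \<in> roots" "Pos c'" "Pos (- y c')" "c' = c \<or> c' = - c"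
    using *[OF c] by blast
  have "s b' = s b" "s c' = s c" "b' \<noteq> c'" using b'(4) c'(4) ne by auto
  then show ?thesis using peak_Pos[OF y b'(1-3) c'(1-3)] by simp
qed

section \<open>Paths in the Bruhat graph\<close>

text \<open>The sum of the lengths of the vertices after \<open>w\<close> on the path labelled by
  the given roots; it is the termination measure for the removal of peaks.\<close>

fun path_length :: "('v \<Rightarrow> 'v) \<Rightarrow> 'v list \<Rightarrow> nat" where
  "path_length w [] = 0"
| "path_length w (b # bs) = len (w \<circ> s b) + path_length (w \<circ> s b) bs"

fun ascending :: "('v \<Rightarrow> 'v) \<Rightarrow> 'v list \<Rightarrow> bool" where
  "ascending w [] \<longleftrightarrow> True"
| "ascending w (b # bs) \<longleftrightarrow> len w < len (w \<circ> s b) \<and> ascending (w \<circ> s b) bs"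

lemma path_length_append:
  "path_length w (us @ vs) = path_length w us + path_length (w \<circ> P us) vs"
  by (induction us arbitrary: w) (auto simp: comp_assoc)

lemma ascending_append:
  "ascending w (us @ vs) \<longleftrightarrow> ascending w us \<and> ascending (w \<circ> P us) vs"
  by (induction us arbitrary: w) (auto simp: comp_assoc)

lemma weyl_P: "set bs \<subseteq> roots \<Longrightarrow> P bs \<in> weyl"
  by (induction bs) (auto simp only: reflection_prod_Nil reflection_prod_Cons weyl_id
      intro!: weyl_comp weyl_s simp: insert_subset list.set)

text \<open>No step is level by \<open>len_neq\<close>, so the first step that fails to ascend
  either opens the path or follows an ascent. From \<open>id\<close> only the latter, a peak, can
  occur.\<close>

lemma not_ascending:
  assumes "w \<in> weyl" "set bs \<subseteq> roots" "\<not> ascending w bs"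
  shows "len (w \<circ> s (hd bs)) < len w \<or> (\<exists>us b c vs. bs = us @ b # c # vs \<and>
    len (w \<circ> P us) < len (w \<circ> P us \<circ> s b) \<and> len (w \<circ> P us \<circ> s b \<circ> s c) < len (w \<circ> P us \<circ> s b))"
  using assms
proof (induction bs arbitrary: w)
  case (Cons b bs)
  have b: "b \<in> roots" using Cons.prems by simp
  show ?case
  proof (cases "len w < len (w \<circ> s b)")
    case True
    have "w \<circ> s b \<in> weyl" by (rule weyl_comp[OF Cons.prems(1) weyl_s[OF b]])
    moreover have "\<not> ascending (w \<circ> s b) bs" "set bs \<subseteq> roots"
      using Cons.prems True by auto
    ultimately consider "len (w \<circ> s b \<circ> s (hd bs)) < len (w \<circ> s b)" |
      us b' c vs where "bs = us @ b' # c # vs" "len (w \<circ> s b \<circ> P us) < len (w \<circ> s b \<circ> P us \<circ> s b')"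
        "len (w \<circ> s b \<circ> P us \<circ> s b' \<circ> s c) < len (w \<circ> s b \<circ> P us \<circ> s b')"
      using Cons.IH[of "w \<circ> s b"] by blast
    then show ?thesis
    proof cases
      case 1
      have "bs \<noteq> []" using \<open>\<not> ascending (w \<circ> s b) bs\<close> by auto
      then obtain c vs where "bs = c # vs" by (cases bs) auto
      then have "b # bs = [] @ b # c # vs \<and> len (w \<circ> P []) < len (w \<circ> P [] \<circ> s b) \<and>
          len (w \<circ> P [] \<circ> s b \<circ> s c) < len (w \<circ> P [] \<circ> s b)"
        using 1 True by simp
      then show ?thesis by blast
    next
      case 2
      then have "b # bs = (b # us) @ b' # c # vs \<and>
          len (w \<circ> P (b # us)) < len (w \<circ> P (b # us) \<circ> s b') \<and>
          len (w \<circ> P (b # us) \<circ> s b' \<circ> s c) < len (w \<circ> P (b # us) \<circ> s b')"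
        by (simp add: comp_assoc)
      then show ?thesis by blast
    qed
  next
    case False
    then have "len (w \<circ> s b) < len w" using len_neq[OF Cons.prems(1) b] by linarith
    then show ?thesis by (intro disjI1) (simp only: list.sel)
  qed
qed simp

text \<open>A Hurwitz move alters only the vertex between its two factors.\<close>

lemma path_length_exchange:
  assumes "s b' \<circ> s c' = s b \<circ> s c" "len (P us \<circ> s b') < len (P us \<circ> s b)"
  shows "path_length id (us @ b' # c' # vs) < path_length id (us @ b # c # vs)"
  using assms by (simp add: path_length_append comp_assoc)

lemma heq_roots: "bs \<simeq> cs \<Longrightarrow> set bs \<subseteq> roots \<Longrightarrow> set cs \<subseteq> roots"
  by (rule hurwitz_eq_closed[of form _ _ roots]) (auto intro: roots_closed roots_uminus)

text \<open>A path from \<open>id\<close> that does not ascend has a peak. Either its two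
  reflections coincide and form the pair, or \<open>peak\<close> provides a move that lowers
  \<open>path_length\<close>.\<close>

lemma ascending_or_pair:
  assumes "set bs \<subseteq> roots"
  shows "\<exists>cs. bs \<simeq> cs \<and> (ascending id cs \<or> (\<exists>us b vs. cs = us @ b # b # vs))"
  using assms
proof (induction "path_length id bs" arbitrary: bs rule: less_induct)
  case less
  show ?case
  proof (cases "ascending id bs")
    case True
    then show ?thesis using hurwitz_eq.refl by blast
  next
    case False
    then obtain us b c vs where bs: "bs = us @ b # c # vs"
      and up: "len (P us) < len (P us \<circ> s b)" and down: "len (P us \<circ> s b \<circ> s c) < len (P us \<circ> s b)"
      using not_ascending[OF weyl_id less.prems] by (auto simp: len_id)
    have r: "b \<in> roots" "c \<in> roots" "P us \<in> weyl" using less.prems weyl_P by (auto simp: bs)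
    have n: "form b b = 2" "form c c = 2" using r roots_norm2 by auto
    show ?thesis
    proof (cases "b = c \<or> b = - c")
      case True
      moreover have "us @ b # c # vs \<simeq> us @ b # (- c) # vs"
        using hurwitz_eq.neg[of form "us @ [b]" c vs] by simp
      ultimately show ?thesis using bs hurwitz_eq.refl by blast
    next
      case False
      let ?y = "P us \<circ> s b"
      have "len (?y \<circ> s b \<circ> s c) < len ?y \<or> len (?y \<circ> s c \<circ> s b) < len ?y"
        using False up down r n by (intro peak weyl_comp weyl_s) (auto simp: comp_assoc)
      moreover have "?y \<circ> s b \<circ> s c = P us \<circ> s c" "?y \<circ> s c \<circ> s b = P us \<circ> s (s b c)"
        using n by (simp_all add: comp_assoc s_conjugate)
      ultimately consider "len (P us \<circ> s c) < len ?y" | "len (P us \<circ> s (s b c)) < len ?y" by auto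
      then obtain cs where cs: "bs \<simeq> cs" "path_length id cs < path_length id bs"
      proof cases
        case 1
        have "path_length id (us @ c # s c b # vs) < path_length id bs"
          unfolding bs using 1 n by (intro path_length_exchange) (auto simp: s_conjugate comp_assoc)
        then show ?thesis using that hurwitz_eq.right bs by blast
      next
        case 2
        have "path_length id (us @ s b c # b # vs) < path_length id bs"
          unfolding bs using 2 n by (intro path_length_exchange) (auto simp: s_conjugate comp_assoc)
        then show ?thesis using that hurwitz_eq.left bs by blast
      qed
      then show ?thesis
        using less.hyps[OF cs(2)] heq_roots[OF cs(1) less.prems] hurwitz_eq.trans by blast
    qed
  qed
qed

section \<open>Sorting factorizations of products of distinct simple reflections\<close>

lemma coord_W: "set ks \<subseteq> I \<Longrightarrow> i \<in> I \<Longrightarrow> i \<notin> set ks \<Longrightarrow> coord i (W ks v) = coord i v"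
proof (induction ks)
  case (Cons j ks)
  then show ?case by (simp add: s_eq norm_\<alpha> coord_\<alpha>)
qed simp

text \<open>The last letter \<open>i\<close> of a nonempty word negates \<open>\<alpha> i\<close>,
  and the other letters do not affect coordinate \<open>i\<close>.\<close>

lemma W_distinct_id:
  assumes "set ks \<subseteq> I" "distinct ks" "W ks = id"
  shows "ks = []"
proof (rule ccontr)
  assume "ks \<noteq> []"
  then obtain js i where ks: "ks = js @ [i]" by (metis rev_exhaust)
  then have i: "i \<in> I" "i \<notin> set js" "set js \<subseteq> I" using assms by auto
  have "coord i (W js (- \<alpha> i)) = -1" using coord_W[OF i(3,1,2)] i by (simp add: coord_\<alpha>)
  moreover have "W ks (\<alpha> i) = W js (- \<alpha> i)" using i norm_\<alpha> by (simp add: ks)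
  ultimately show False using assms(3) i by (simp add: coord_\<alpha>)
qed

text \<open>The last factor is a descent of \<open>W ks\<close>, so by exchange it removes one
  letter \<open>i\<close>. The induction hypothesis sorts the rest into \<open>as @ cs\<close>, and
  moving the last root to the left through \<open>cs\<close> turns it into \<open>\<alpha> i\<close>
  at its place.\<close>

lemma heq_simple_if_ascending:
  assumes "ascending id bs" "set bs \<subseteq> roots" "P bs = W ks" "set ks \<subseteq> I" "distinct ks"
  shows "bs \<simeq> map \<alpha> ks"
  using assms
proof (induction bs arbitrary: ks rule: rev_induct)
  case Nil
  then have "W ks = id" by (simp only: reflection_prod_Nil)
  then have "ks = []" using W_distinct_id Nil.prems by blast
  then show ?case by (simp add: hurwitz_eq.refl)
next
  case (snoc b bs)
  have b: "b \<in> roots" "set bs \<subseteq> roots" using snoc.prems(2) by auto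
  have "ascending id bs \<and> len (P bs) < len (P bs \<circ> s b)"
    using snoc.prems(1) unfolding ascending_append ascending.simps id_comp by blast
  then have asc: "ascending id bs" "len (P bs) < len (P bs \<circ> s b)" by blast+
  obtain d where d: "d \<in> roots" "Pos d" "d = b \<or> d = - b"
    using root_Pos_or_neg[OF b(1)] b roots_uminus by blast
  have sd: "s d = s b" using d(3) by auto
  have Wks: "W ks = P bs \<circ> s b"
    using snoc.prems(3) by (simp only: reflection_prod_append reflection_prod_Cons reflection_prod_Nil comp_id)
  have Pd: "W ks \<circ> s d = P bs"
    by (simp only: Wks sd comp_assoc s_comp_s roots_norm2[OF b(1)] comp_id)
  have "len (W ks \<circ> s d) < len (W ks)"
    unfolding Pd unfolding Wks by (rule asc(2))
  then have "Pos (- W ks d)"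
    using len_less_iff[OF weyl_W[OF snoc.prems(4)] d(1,2)] by simp
  then obtain as i cs where ks: "ks = as @ i # cs" and cs: "W cs d = \<alpha> i"
    using exchange[OF snoc.prems(4) d(1,2)] by blast
  have Pbs: "P bs = W (as @ cs)"
    using exchange_delete[of as i cs d] cs snoc.prems(4) Pd by (simp add: ks)
  have IH: "bs \<simeq> map \<alpha> (as @ cs)"
    by (rule snoc.IH[OF asc(1) b(2) Pbs]) (use snoc.prems(4,5) in \<open>auto simp: ks\<close>)
  have "bs @ [b] \<simeq> bs @ [d]"
    using d(3) hurwitz_eq.neg[of form bs b "[]"] by (auto intro: hurwitz_eq.refl)
  also have "bs @ [d] \<simeq> map \<alpha> (as @ cs) @ [d]"
    using hurwitz_eq_context[OF IH, of "[]" "[d]"] by simp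
  also have "map \<alpha> (as @ cs) @ [d] \<simeq> map \<alpha> ks"
    using hurwitz_eq_context[OF heq_move_left[of "map \<alpha> cs" d], of "map \<alpha> as" "[]"]
      snoc.prems(4) word_norm2[of cs] by (simp add: cs ks)
  finally show ?case .
qed

text \<open>A pair found by \<open>ascending_or_pair\<close> is moved to the end; cancelling it
  leaves a shorter factorization of the same element.\<close>

theorem heq_simple_pairs:
  assumes "set bs \<subseteq> roots" "P bs = W ks" "set ks \<subseteq> I" "distinct ks"
  shows "\<exists>cs. bs \<simeq> map \<alpha> ks @ concat (map (\<lambda>c. [c, c]) cs)"
  using assms(1,2)
proof (induction "length bs" arbitrary: bs rule: less_induct)
  case less
  obtain cs where cs: "bs \<simeq> cs" "ascending id cs \<or> (\<exists>us b vs. cs = us @ b # b # vs)"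
    using ascending_or_pair[OF less.prems(1)] by blast
  have r: "set cs \<subseteq> roots" by (rule heq_roots[OF cs(1) less.prems(1)])
  have norm: "set bs \<subseteq> norm2" "set cs \<subseteq> norm2" using r less.prems(1) roots_norm2 by auto
  have prod: "P cs = W ks" using heq_prod[OF cs(1) norm(1)] less.prems(2) by simp
  from cs(2) show ?case
  proof
    assume "ascending id cs"
    then have "cs \<simeq> map \<alpha> ks" using heq_simple_if_ascending r prod assms(3,4) by blast
    then show ?thesis using hurwitz_eq.trans[OF cs(1)] by (intro exI[of _ "[]"]) simp
  next
    assume "\<exists>us b vs. cs = us @ b # b # vs"
    then obtain us b vs where eq: "cs = us @ b # b # vs" by blast
    have n: "form b b = 2" using norm eq by simp
    have "us @ b # b # vs \<simeq> us @ vs @ [b, b]"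
      using hurwitz_eq_context[OF heq_move_pair_right[OF n, of vs], of us "[]"] norm eq by simp
    then have "bs \<simeq> (us @ vs) @ [b, b]" using cs(1) eq hurwitz_eq.trans by auto
    moreover have "P (us @ vs) = W ks" using prod n by (simp add: eq comp_assoc)
    moreover have "set (us @ vs) \<subseteq> roots" "length (us @ vs) < length bs"
      using r hurwitz_eq_length[OF cs(1)] by (auto simp: eq)
    ultimately obtain ds where "us @ vs \<simeq> map \<alpha> ks @ concat (map (\<lambda>c. [c, c]) ds)"
      using less.hyps by blast
    then have "(us @ vs) @ [b, b] \<simeq> map \<alpha> ks @ concat (map (\<lambda>c. [c, c]) (ds @ [b]))"
      using hurwitz_eq_context[of form "us @ vs" _ "[]" "[b, b]"] by fastforce
    then show ?thesis using \<open>bs \<simeq> (us @ vs) @ [b, b]\<close> hurwitz_eq.trans by blast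
  qed
qed

corollary heq_simple_pair:
  assumes "set bs \<subseteq> roots" "P bs = W ks" "set ks \<subseteq> I" "distinct ks" "length bs = length ks + 2"
  obtains c where "c \<in> roots" "bs \<simeq> map \<alpha> ks @ [c, c]"
proof -
  obtain cs where cs: "bs \<simeq> map \<alpha> ks @ concat (map (\<lambda>c. [c, c]) cs)"
    using heq_simple_pairs[OF assms(1-4)] by blast
  have "length (concat (map (\<lambda>c. [c, c]) cs)) = 2 * length cs" by (induction cs) auto
  then have "length cs = 1" using hurwitz_eq_length[OF cs] assms(5) by simp
  then obtain c where "cs = [c]" by (cases cs) auto
  then show ?thesis using that[of c] cs heq_roots[OF cs assms(1)] by simp
qed

end

section \<open>The extended space modulo the radical vector\<close>

lemma finite_vertices: "finite (vertices p)"
  by (simp flip: set_vertex_list)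

lemma gram_entry_sym: "gram_entry x y = gram_entry y x"
proof -
  have "{x, y} = {y, x}" by blast
  then show ?thesis by (auto simp: gram_entry_def dotted_edge_def single_edge_def)
qed

lemma gram_entry_Base [simp]:
  "gram_entry Base Base = 2" "gram_entry Base Base_star = 2" "gram_entry Base_star Base_star = 2"
  "gram_entry Base (Arm i j) = (if j = 1 then -1 else 0)"
  "gram_entry Base_star (Arm i j) = (if j = 1 then -1 else 0)"
  "gram_entry Base_star Base = 2"
  "gram_entry (Arm i j) Base = (if j = 1 then -1 else 0)"
  "gram_entry (Arm i j) Base_star = (if j = 1 then -1 else 0)"
  by (auto simp: gram_entry_def dotted_edge_def single_edge_def doubleton_eq_iff)

lemma gram_entry_Arm:
  "gram_entry (Arm i j) (Arm i' j') =
     (if i = i' \<and> j = j' then 2 else if i = i' \<and> (j = Suc j' \<or> j' = Suc j) then -1 else 0)"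
  by (auto simp: gram_entry_def dotted_edge_def single_edge_def doubleton_eq_iff)

lemma gram_entry_same [simp]: "gram_entry x x = 2"
  by (simp add: gram_entry_def)

lemma gram_entry_cases:
  "x \<noteq> Base_star \<Longrightarrow> y \<noteq> Base_star \<Longrightarrow> x \<noteq> y \<Longrightarrow> gram_entry x y = 0 \<or> gram_entry x y = -1"
  by (auto simp: gram_entry_def dotted_edge_def doubleton_eq_iff)

lemma gram_entry_Ints: "gram_entry x y \<in> \<int>"
  by (auto simp: gram_entry_def)

lemma Base_vertices [simp]: "Base \<in> vertices p" "Base_star \<in> vertices p"
  by (auto simp: vertices_def)

section \<open>The radical vector and the projection along it\<close>

context extended_space
begin

lemma form_sym: "form x y = form y x"
proof (rule bilinear_eq[where B = "\<alpha> ` vertices p" and C = "\<alpha> ` vertices p" and g = "\<lambda>x y. form y x"])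
  show "bilinear (\<lambda>x y. form y x)"
    using bilinear_form by (simp add: bilinear_def)
qed (auto simp: bilinear_form span_basis form_basis gram_entry_sym)

definition rep :: "vertex \<Rightarrow> 'v \<Rightarrow> real" where
  "rep \<nu> v = representation (\<alpha> ` vertices p) v (\<alpha> \<nu>)"

lemma linear_rep: "linear (rep \<nu>)"
  by (rule linearI)
    (simp_all add: rep_def representation_add representation_scale independent_basis span_basis)

lemma rep_simps [simp]:
  "rep \<nu> (u + v) = rep \<nu> u + rep \<nu> v" "rep \<nu> (u - v) = rep \<nu> u - rep \<nu> v"
  "rep \<nu> (c *\<^sub>R v) = c * rep \<nu> v" "rep \<nu> (- v) = - rep \<nu> v" "rep \<nu> 0 = 0"
  using linear_rep[of \<nu>]
  by (simp_all add: linear_add linear_diff linear_scale linear_neg linear_0)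

lemma rep_\<alpha>: "\<nu> \<in> vertices p \<Longrightarrow> \<omega> \<in> vertices p \<Longrightarrow> rep \<nu> (\<alpha> \<omega>) = (if \<nu> = \<omega> then 1 else 0)"
  using inj_basis by (auto simp: rep_def representation_basis[OF independent_basis] inj_on_def)

definition \<delta> :: 'v where "\<delta> = \<alpha> Base_star - \<alpha> Base"
text \<open>The projection along \<open>\<delta>\<close> onto the span of the simple roots other
  than \<open>\<alpha> Base_star\<close>: a copy of the quotient by \<open>\<delta>\<close> inside
  the space itself.\<close>

definition proj :: "'v \<Rightarrow> 'v" where "proj v = v - rep Base_star v *\<^sub>R \<delta>"
text \<open>The reflections in \<open>\<alpha> Base\<close> and \<open>\<alpha> Base_star\<close> agree modulo \<open>\<delta>\<close>, so the coordinate at \<open>Base\<close> of the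
  quotient by \<open>\<delta>\<close> absorbs the one at \<open>Base_star\<close>.\<close>

definition coord :: "vertex \<Rightarrow> 'v \<Rightarrow> real" where
  "coord \<nu> v = rep \<nu> v + (if \<nu> = Base then rep Base_star v else 0)"
abbreviation "I \<equiv> vertices p - {Base_star}"

text \<open>Deleting \<open>Base_star\<close> removes the only entry 2 off the diagonal, so a simply
  laced diagram remains.\<close>

sublocale root_basis form I \<alpha> coord
proof (rule root_basis.intro)
  show "symmetric_form form"
    by (rule symmetric_form.intro) (rule bilinear_form, rule form_sym)
  show "root_basis_axioms form I \<alpha> coord"
  proof (rule root_basis_axioms.intro)
    show "linear (coord \<nu>)" for \<nu>
      by (rule linearI) (auto simp: coord_def algebra_simps)
  qed (use finite_vertices gram_entry_cases in \<open>auto simp: form_basis coord_def rep_\<alpha>\<close>)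
qed

lemma \<delta>_nonzero: "\<delta> \<noteq> 0"
  using inj_onD[OF inj_basis, of Base_star Base] by (auto simp: \<delta>_def)

text \<open>\<open>Base\<close> and \<open>Base_star\<close> have equal rows in the Gram
  matrix.\<close>

lemma form_\<delta>_right [simp]: "form v \<delta> = 0"
proof -
  have "form v \<delta> = 0" if "v \<in> span (\<alpha> ` vertices p)" for v
    using that
  proof (induction rule: span_induct_alt)
    case (step c x y)
    then obtain \<nu> where "\<nu> \<in> vertices p" "x = \<alpha> \<nu>" by blast
    then have "form x \<delta> = 0"
      by (cases \<nu>) (simp_all add: \<delta>_def form_basis)
    then show ?case using step by simp
  qed simp
  then show ?thesis using span_basis by blast
qed

lemma form_\<delta>_left [simp]: "form \<delta> v = 0"
  using form_\<delta>_right sym by metis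

lemma linear_proj: "linear proj"
  by (rule linearI) (simp_all add: proj_def algebra_simps)

lemma rep_\<delta> [simp]: "rep Base_star \<delta> = 1"
  by (simp add: \<delta>_def rep_\<alpha>)

lemma coord_\<delta> [simp]: "\<nu> \<in> I \<Longrightarrow> coord \<nu> \<delta> = 0"
  by (auto simp: \<delta>_def rep_\<alpha> coord_def)

lemma proj_\<alpha> [simp]: "\<nu> \<in> I \<Longrightarrow> proj (\<alpha> \<nu>) = \<alpha> \<nu>" "proj (\<alpha> Base_star) = \<alpha> Base"
  by (auto simp: proj_def rep_\<alpha> \<delta>_def)

lemma proj_plus_\<delta>: "proj v + rep Base_star v *\<^sub>R \<delta> = v"
  by (simp add: proj_def)

lemma form_proj [simp]: "form (proj u) v = form u v" "form u (proj v) = form u v"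
  by (simp_all add: proj_def)

lemma coord_proj [simp]: "\<nu> \<in> I \<Longrightarrow> coord \<nu> (proj v) = coord \<nu> v"
  by (simp add: proj_def)

lemma proj_s: "proj (s a v) = s (proj a) (proj v)"
  by (simp add: reflection_def linear_diff[OF linear_proj] linear_scale[OF linear_proj])

lemma proj_P: "proj (P xs v) = P (map proj xs) (proj v)"
  by (induction xs) (auto simp: proj_s)

lemma P_\<delta>: "P xs \<delta> = \<delta>"
  by (induction xs) (auto simp: reflection_def)

text \<open>The projected product sends \<open>proj v\<close> to the projection of
  \<open>P xs v\<close> and fixes \<open>\<delta>\<close>, which determines it.\<close>

lemma P_map_proj_cong:
  assumes "P xs = P ys"
  shows "P (map proj xs) = P (map proj ys)"
proof
  fix v
  have *: "P (map proj zs) v = proj (P zs v) + rep Base_star v *\<^sub>R \<delta>" for zs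
  proof -
    have "P (map proj zs) v = P (map proj zs) (proj v + rep Base_star v *\<^sub>R \<delta>)"
      by (simp add: proj_plus_\<delta>)
    then show ?thesis
      by (simp only: linear_add[OF linear_P] linear_scale[OF linear_P] P_\<delta> proj_P)
  qed
  show "P (map proj xs) v = P (map proj ys) v" using * assms by simp
qed

text \<open>\<open>proj\<close> commutes with reflections and negation, so the same moves can be
  made before projecting.\<close>

lemma heq_lift:
  assumes "map proj xs \<simeq> zs"
  shows "\<exists>ys. xs \<simeq> ys \<and> map proj ys = zs"
  using assms
proof (induction "map proj xs" zs arbitrary: xs rule: hurwitz_eq.induct)
  case refl
  then show ?case using hurwitz_eq.refl by blast
next
  case (trans ys zs)
  then show ?case using hurwitz_eq.trans by metis
next
  case (right us a b vs)
  then obtain us' a' b' vs' where xs: "xs = us' @ a' # b' # vs'" and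
    eq: "map proj us' = us" "proj a' = a" "proj b' = b" "map proj vs' = vs"
    by (auto simp: append_eq_map_conv Cons_eq_map_conv)
  then show ?case
    using hurwitz_eq.right[of form us' a' b' vs'] by (intro exI[of _ "us' @ b' # s b' a' # vs'"]) (simp add: proj_s)
next
  case (left us a b vs)
  then obtain us' a' b' vs' where xs: "xs = us' @ a' # b' # vs'" and
    eq: "map proj us' = us" "proj a' = a" "proj b' = b" "map proj vs' = vs"
    by (auto simp: append_eq_map_conv Cons_eq_map_conv)
  then show ?case
    using hurwitz_eq.left[of form us' a' b' vs'] by (intro exI[of _ "us' @ s a' b' # a' # vs'"]) (simp add: proj_s)
next
  case (neg us a vs)
  then obtain us' a' vs' where xs: "xs = us' @ a' # vs'" and
    eq: "map proj us' = us" "proj a' = a" "map proj vs' = vs"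
    by (auto simp: append_eq_map_conv Cons_eq_map_conv)
  then show ?case
    using hurwitz_eq.neg[of form us' a' vs'] by (intro exI[of _ "us' @ - a' # vs'"]) (simp add: linear_neg[OF linear_proj])
qed

section \<open>Roots of the extended system\<close>

abbreviation "ext_roots \<equiv> root_system form (\<alpha> ` vertices p)"

lemma \<alpha>_ext_norm2: "\<alpha> ` vertices p \<subseteq> norm2"
  by (auto simp: form_basis)

lemmas ext_roots_closed = root_system_closed[OF \<alpha>_ext_norm2]
lemmas ext_roots_uminus = root_system_uminus[OF \<alpha>_ext_norm2]

lemma ext_roots_norm2: "b \<in> ext_roots \<Longrightarrow> form b b = 2"
  using root_system_norm2[OF \<alpha>_ext_norm2] by auto

lemma proj_roots: "b \<in> ext_roots \<Longrightarrow> proj b \<in> roots"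
proof (induction rule: root_system.induct)
  case (simple a)
  then obtain \<nu> where \<nu>: "\<nu> \<in> vertices p" "a = \<alpha> \<nu>" by blast
  then show ?case by (cases "\<nu> = Base_star") (auto intro: roots_simple)
next
  case (reflect a b)
  then obtain \<nu> where \<nu>: "\<nu> \<in> vertices p" "a = \<alpha> \<nu>" by blast
  then have "proj a \<in> roots" by (cases "\<nu> = Base_star") (auto intro: roots_simple)
  then show ?case using reflect by (simp add: proj_s roots_closed)
qed

lemma ext_roots_form_Ints: "a \<in> ext_roots \<Longrightarrow> b \<in> ext_roots \<Longrightarrow> form a b \<in> \<int>"
  by (rule root_system_form_Ints[OF \<alpha>_ext_norm2]) (auto simp: form_basis gram_entry_Ints)

text \<open>Integrality serves two ends: the shift of the final pair along \<open>\<delta>\<close>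
  can be undone in integral steps, and the equation of \<open>lifted_coord\<close> leaves only the
  values 1 and -1.\<close>

lemma ext_roots_rep_Ints: "b \<in> ext_roots \<Longrightarrow> \<nu> \<in> vertices p \<Longrightarrow> rep \<nu> b \<in> \<int>"
proof (induction rule: root_system.induct)
  case (simple a)
  then show ?case by (auto simp: rep_\<alpha>)
next
  case (reflect a b)
  then obtain \<omega> where \<omega>: "\<omega> \<in> vertices p" "a = \<alpha> \<omega>" by blast
  have "form a b \<in> \<int>"
    by (rule ext_roots_form_Ints[OF root_system.simple[OF reflect.hyps(1)] reflect.hyps(2)])
  moreover have "s a b = b - form a b *\<^sub>R a" using \<omega> by (simp add: s_eq form_basis)
  moreover have "rep \<nu> a \<in> \<int>" using \<omega> reflect.prems by (simp add: rep_\<alpha>)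
  ultimately show ?case using reflect.IH[OF reflect.prems] by simp
qed

lemma heq_ext_roots: "bs \<simeq> cs \<Longrightarrow> set bs \<subseteq> ext_roots \<Longrightarrow> set cs \<subseteq> ext_roots"
  by (rule hurwitz_eq_closed[of form _ _ ext_roots]) (auto intro: ext_roots_closed ext_roots_uminus)

section \<open>Transvections along \<delta>\<close>

lemma coord_span_zero:
  assumes "v \<in> span (\<alpha> ` K)" "K \<subseteq> I" "\<nu> \<in> I" "\<nu> \<notin> K"
  shows "coord \<nu> v = 0"
  using assms(1)
proof (induction rule: span_induct_alt)
  case (step c x y)
  then obtain \<omega> where "\<omega> \<in> K" "x = \<alpha> \<omega>" by blast
  moreover have "\<omega> \<in> I" "\<nu> \<noteq> \<omega>" using \<open>\<omega> \<in> K\<close> assms by auto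
  ultimately have "coord \<nu> x = 0" using coord_\<alpha>[of \<nu> \<omega>] assms(3) by simp
  then show ?case using step assms(3) by simp
qed (use assms(3) in simp)

lemma span_W:
  assumes "set ks \<subseteq> K" "K \<subseteq> I" "v \<in> span (\<alpha> ` K)"
  shows "W ks v \<in> span (\<alpha> ` K)"
  using assms(1)
proof (induction ks)
  case (Cons k ks)
  then show ?case by (auto simp: reflection_def intro!: span_diff span_scale intro: span_base)
qed (simp add: assms)

text \<open>The reflection in \<open>\<alpha> i + k \<delta>\<close> is the one in \<open>\<alpha> i\<close> followed by a transvection along \<open>\<delta>\<close>; the vector
  \<open>x\<close> collects these transvections.\<close>

lemma lift_simple_product:
  assumes "map proj ys = map \<alpha> ks" "set ks \<subseteq> I" "distinct ks"
  shows "\<exists>x \<in> span (\<alpha> ` set ks). (\<forall>v. P ys v = W ks v + form x v *\<^sub>R \<delta>) \<and> (x = 0 \<longrightarrow> ys = map \<alpha> ks)"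
  using assms
proof (induction ks arbitrary: ys)
  case Nil
  then show ?case by (simp add: span_zero)
next
  case (Cons i ks)
  then obtain y ys' where ys: "ys = y # ys'" "proj y = \<alpha> i" "map proj ys' = map \<alpha> ks"
    by (auto simp: map_eq_Cons_conv)
  have i: "i \<in> I" "i \<notin> set ks" "set ks \<subseteq> I" "distinct ks" using Cons.prems by auto
  obtain x where x: "x \<in> span (\<alpha> ` set ks)" "\<And>v. P ys' v = W ks v + form x v *\<^sub>R \<delta>"
    "x = 0 \<longrightarrow> ys' = map \<alpha> ks"
    using Cons.IH[OF ys(3) i(3,4)] by blast
  define k where "k = rep Base_star y"
  have y: "y = \<alpha> i + k *\<^sub>R \<delta>" using proj_plus_\<delta>[of y] by (simp add: ys(2) k_def)
  have n: "form (\<alpha> i) (\<alpha> i) = 2" by (rule norm_\<alpha>[OF i(1)])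
  have sy: "s y v = s (\<alpha> i) v - (k * form (\<alpha> i) v) *\<^sub>R \<delta>" for v
    using n by (simp add: y s_eq algebra_simps)
  \<comment> \<open>The isometry \<open>W ks\<close> moves to the other argument: pairing
    \<open>\<alpha> i\<close> with \<open>W ks v\<close> is pairing \<open>u\<close> with
    \<open>v\<close>.\<close>
  define u where "u = W (rev ks) (\<alpha> i)"
  have norm: "set (map \<alpha> ks) \<subseteq> norm2" using word_norm2[OF i(3)] by simp
  have fu: "form (\<alpha> i) (W ks v) = form u v" for v
    using form_P[OF norm, of u v] P_rev(2)[OF norm] by (simp add: u_def rev_map)
  have "P ys v = W (i # ks) v + form (x - k *\<^sub>R u) v *\<^sub>R \<delta>" for v
  proof -
    have "P ys v = s y (W ks v) + form x v *\<^sub>R s y \<delta>"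
      by (simp add: ys(1) x(2) linear_add[OF linear_s] linear_scale[OF linear_s])
    moreover have "s y \<delta> = \<delta>" by (simp add: reflection_def)
    ultimately show ?thesis by (simp add: sy fu algebra_simps)
  qed
  moreover have "u \<in> span (\<alpha> ` insert i (set ks))"
    unfolding u_def using i by (intro span_W) (auto intro: span_base)
  then have "x - k *\<^sub>R u \<in> span (\<alpha> ` set (i # ks))"
    using x(1) span_mono[of "\<alpha> ` set ks" "\<alpha> ` insert i (set ks)"]
    by (auto intro!: span_diff span_scale)
  \<comment> \<open>Coordinate \<open>i\<close> is 0 at \<open>x\<close> and 1 at \<open>u\<close>,
    since \<open>i\<close> does not occur in \<open>ks\<close>; this forces
    \<open>k = 0\<close>.\<close>
  moreover have "ys = map \<alpha> (i # ks)" if "x - k *\<^sub>R u = 0"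
  proof -
    have "coord i x = 0" using coord_span_zero[OF x(1) i(3,1,2)] .
    moreover have "coord i u = 1"
      unfolding u_def using coord_W[of "rev ks" i "\<alpha> i"] i coord_\<alpha>[of i i] by simp
    moreover have "coord i (x - k *\<^sub>R u) = 0" using that i(1) by simp
    ultimately have "k = 0" using i(1) by simp
    then show ?thesis using that x(3) ys(1) y by simp
  qed
  ultimately show ?case by blast
qed

text \<open>The two reflections agree modulo \<open>\<delta>\<close>, so only a transvection along
  \<open>\<delta>\<close> is left of their product.\<close>

lemma pair_product:
  assumes "form g g = 2"
  shows "P [g + k *\<^sub>R \<delta>, g + l *\<^sub>R \<delta>] v = v + ((k - l) * form g v) *\<^sub>R \<delta>"
  using assms by (simp add: s_eq algebra_simps scaleR_2)

section \<open>Moving a pair of roots that agree modulo \<delta>\<close>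

text \<open>Each root of \<open>bs\<close> is conjugated by both members of the pair. Modulo
  \<open>\<delta>\<close> these are the same involution, so the projections do not change.\<close>

lemma heq_pair_left:
  assumes "set bs \<subseteq> norm2" "form g1 g1 = 2" "form g2 g2 = 2" "proj g1 = proj g2"
  shows "\<exists>bs'. bs @ [g1, g2] \<simeq> [g1, g2] @ bs' \<and> map proj bs' = map proj bs"
  using assms(1)
proof (induction bs)
  case Nil
  then show ?case using hurwitz_eq.refl by (intro exI[of _ "[]"]) simp
next
  case (Cons b bs)
  then obtain bs' where bs': "bs @ [g1, g2] \<simeq> [g1, g2] @ bs'" "map proj bs' = map proj bs" by auto
  let ?b = "s g2 (s g1 b)"
  have "(b # bs) @ [g1, g2] \<simeq> b # g1 # g2 # bs'"
    using hurwitz_eq_context[OF bs'(1), of "[b]" "[]"] by simp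
  also have "b # g1 # g2 # bs' \<simeq> g1 # s g1 b # g2 # bs'"
    using hurwitz_eq.right[of form "[]" b g1 "g2 # bs'"] by simp
  also have "g1 # s g1 b # g2 # bs' \<simeq> g1 # g2 # ?b # bs'"
    using hurwitz_eq.right[of form "[g1]" "s g1 b" g2 bs'] by simp
  finally have "(b # bs) @ [g1, g2] \<simeq> [g1, g2] @ ?b # bs'" by simp
  moreover have "proj ?b = proj b"
    using assms by (simp add: proj_s)
  ultimately show ?case using bs'(2) by (intro exI[of _ "?b # bs'"]) simp
qed

lemma heq_pair_right:
  assumes "set bs \<subseteq> norm2" "form g1 g1 = 2" "form g2 g2 = 2" "proj g1 = proj g2"
  shows "\<exists>bs'. [g1, g2] @ bs \<simeq> bs' @ [g1, g2] \<and> map proj bs' = map proj bs"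
  using assms(1)
proof (induction bs)
  case Nil
  then show ?case using hurwitz_eq.refl by (intro exI[of _ "[]"]) simp
next
  case (Cons b bs)
  then obtain bs' where bs': "[g1, g2] @ bs \<simeq> bs' @ [g1, g2]" "map proj bs' = map proj bs" by auto
  let ?b = "s g1 (s g2 b)"
  have "[g1, g2] @ b # bs \<simeq> g1 # s g2 b # g2 # bs"
    using hurwitz_eq.left[of form "[g1]" g2 b bs] by simp
  also have "g1 # s g2 b # g2 # bs \<simeq> ?b # g1 # g2 # bs"
    using hurwitz_eq.left[of form "[]" g1 "s g2 b" "g2 # bs"] by simp
  also have "?b # g1 # g2 # bs \<simeq> (?b # bs') @ [g1, g2]"
    using hurwitz_eq_context[OF bs'(1), of "[?b]" "[]"] by simp
  finally have "[g1, g2] @ b # bs \<simeq> (?b # bs') @ [g1, g2]" .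
  moreover have "proj ?b = proj b"
    using assms by (simp add: proj_s)
  ultimately show ?case using bs'(2) by (intro exI[of _ "?b # bs'"]) simp
qed

text \<open>The pair moves left past \<open>bs\<close> at the cost of changing \<open>bs\<close> by multiples of \<open>\<delta>\<close>, is conjugated by \<open>y\<close>,
  and moves right again.\<close>

lemma heq_pair_conjugate:
  assumes norm: "set (as @ y # bs) \<subseteq> norm2" "form g1 g1 = 2" "form g2 g2 = 2" and eq: "proj g1 = proj g2"
  shows "\<exists>zs g1' g2'. (as @ y # bs) @ [g1, g2] \<simeq> zs @ [g1', g2'] \<and>
    map proj zs = map proj (as @ y # bs) \<and>
    proj g1' = s (proj y) (proj g1) \<and> proj g2' = s (proj y) (proj g1)"
proof -
  have n: "form y y = 2" "set bs \<subseteq> norm2" using norm(1) by auto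
  obtain bs' where bs': "bs @ [g1, g2] \<simeq> [g1, g2] @ bs'" "map proj bs' = map proj bs"
    using heq_pair_left[OF n(2) norm(2,3) eq] by blast
  have n': "set bs' \<subseteq> norm2"
    using heq_prod[OF bs'(1)] n norm by simp
  have "as @ y # bs @ [g1, g2] \<simeq> as @ y # g1 # g2 # bs'"
    using hurwitz_eq_context[OF bs'(1), of "as @ [y]" "[]"] by simp
  also have "as @ y # g1 # g2 # bs' \<simeq> as @ s y g1 # y # g2 # bs'"
    by (rule hurwitz_eq.left)
  also have "as @ s y g1 # y # g2 # bs' \<simeq> as @ s y g1 # s y g2 # y # bs'"
    using hurwitz_eq.left[of form "as @ [s y g1]" y g2 bs'] by simp
  finally have 1: "as @ y # bs @ [g1, g2] \<simeq> as @ [s y g1, s y g2] @ y # bs'" by simp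
  have "proj (s y g1) = proj (s y g2)" using eq by (simp add: proj_s)
  moreover have "form (s y g1) (s y g1) = 2" "form (s y g2) (s y g2) = 2" using n norm by auto
  moreover have "set (y # bs') \<subseteq> norm2" using n n' by simp
  ultimately obtain cs where cs: "[s y g1, s y g2] @ y # bs' \<simeq> cs @ [s y g1, s y g2]"
    "map proj cs = map proj (y # bs')"
    using heq_pair_right[of "y # bs'" "s y g1" "s y g2"] \<open>set (y # bs') \<subseteq> norm2\<close> by blast
  have "as @ [s y g1, s y g2] @ y # bs' \<simeq> (as @ cs) @ [s y g1, s y g2]"
    using hurwitz_eq_context[OF cs(1), of as "[]"] by simp
  with 1 have "(as @ y # bs) @ [g1, g2] \<simeq> (as @ cs) @ [s y g1, s y g2]"
    using hurwitz_eq.trans by auto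
  then show ?thesis
    using bs'(2) cs(2) eq by (intro exI[of _ "as @ cs"] exI[of _ "s y g1"] exI[of _ "s y g2"]) (simp add: proj_s)
qed

text \<open>A \<open>right\<close> move followed by \<open>neg\<close> replaces the roots with
  indices \<open>k\<close> and \<open>k + 1\<close> by those with indices \<open>k + 1\<close> and
  \<open>k + 2\<close>. For positive \<open>k\<close> the moves lead from 0 up to \<open>k\<close>
  and are then reversed.\<close>

lemma heq_pair_shift:
  "[\<alpha> Base + of_int k *\<^sub>R \<delta>, \<alpha> Base + (of_int k + 1) *\<^sub>R \<delta>] \<simeq> [\<alpha> Base, \<alpha> Base_star]"
proof -
  define e where "e k = \<alpha> Base + of_int k *\<^sub>R \<delta>" for k :: int
  have n: "form (e k) (e k) = 2" for k by (simp add: e_def form_basis)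
  have step: "[e k, e (k + 1)] \<simeq> [e (k + 1), e (k + 2)]" for k
  proof -
    have "[e k, e (k + 1)] \<simeq> [e (k + 1), s (e (k + 1)) (e k)]"
      using hurwitz_eq.right[of form "[]" "e k" "e (k + 1)" "[]"] by simp
    also have "s (e (k + 1)) (e k) = - e (k + 2)"
    proof -
      have "form (e (k + 1)) (e k) = 2" by (simp add: e_def form_basis)
      then have "s (e (k + 1)) (e k) = e k - (e (k + 1) + e (k + 1))"
        by (simp only: s_eq[OF n] scaleR_2)
      then show ?thesis by (simp add: e_def scaleR_left_distrib scaleR_2)
    qed
    also have "[e (k + 1), - e (k + 2)] \<simeq> [e (k + 1), e (k + 2)]"
      using hurwitz_eq.neg[of form "[e (k + 1)]" "- e (k + 2)" "[]"] by simp
    finally show ?thesis .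
  qed
  have up: "[e k, e (k + 1)] \<simeq> [e (k + int m), e (k + int m + 1)]" for k m
  proof (induction m)
    case (Suc m)
    then show ?case using step[of "k + int m"] by (auto intro: hurwitz_eq.trans simp: algebra_simps)
  qed (simp add: hurwitz_eq.refl)
  have "[e k, e (k + 1)] \<simeq> [e 0, e 1]"
  proof (cases "k \<le> 0")
    case True
    then show ?thesis using up[of k "nat (- k)"] by simp
  next
    case False
    then have "[e 0, e 1] \<simeq> [e k, e (k + 1)]" using up[of 0 "nat k"] by simp
    then show ?thesis by (rule heq_sym) (simp add: n)
  qed
  moreover have "e 0 = \<alpha> Base" "e 1 = \<alpha> Base_star" by (simp_all add: e_def \<delta>_def)
  ultimately show ?thesis by (simp add: e_def)
qed

end

section \<open>Coordinates of roots along the arms\<close>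

context extended_space
begin

lemma form_sum_right: "form x (sum f A) = (\<Sum>a\<in>A. form x (f a))"
  by (induction A rule: infinite_finite_induct) auto

lemma form_\<alpha>_expand:
  assumes "g \<in> span (\<alpha> ` I)" "\<omega> \<in> vertices p"
  shows "form (\<alpha> \<omega>) g = (\<Sum>\<nu>\<in>I. coord \<nu> g * gram_entry \<omega> \<nu>)"
  by (subst span_coord[OF assms(1)])
    (auto simp: form_sum_right form_basis assms(2) intro!: sum.cong)

lemma form_self_expand:
  assumes "g \<in> span (\<alpha> ` I)"
  shows "form g g = (\<Sum>\<nu>\<in>I. coord \<nu> g * form (\<alpha> \<nu>) g)"
proof -
  have "form g g = form g (\<Sum>\<nu>\<in>I. coord \<nu> g *\<^sub>R \<alpha> \<nu>)"
    using span_coord[OF assms] by simp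
  also have "\<dots> = (\<Sum>\<nu>\<in>I. coord \<nu> g * form g (\<alpha> \<nu>))"
    by (simp add: form_sum_right)
  also have "\<dots> = (\<Sum>\<nu>\<in>I. coord \<nu> g * form (\<alpha> \<nu>) g)"
    by (simp only: form_sym[of g "\<alpha> \<nu>" for \<nu>])
  finally show ?thesis .
qed

lemma Pos_if_coord_Base:
  assumes "g \<in> roots" "coord Base g = 1"
  shows "Pos g"
proof -
  have "\<not> Pos (- g)"
  proof
    assume "Pos (- g)"
    then have "coord Base (- g) \<ge> 0" unfolding Pos_def by simp
    then show False using assms(2) by simp
  qed
  then show ?thesis using root_Pos_or_neg[OF assms(1)] by blast
qed

text \<open>Otherwise the coordinates of \<open>g\<close> along each arm are convex and vanish at both ends.\<close>

lemma arm_root_descent: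
  assumes g: "g \<in> roots" "coord Base g = 1" and ne: "g \<noteq> \<alpha> Base"
  shows "\<exists>\<nu> \<in> vertices p - {Base, Base_star}. form (\<alpha> \<nu>) g > 0"
proof (rule ccontr)
  assume "\<not> ?thesis"
  then have neg: "form (\<alpha> \<nu>) g \<le> 0" if "\<nu> \<in> I - {Base}" for \<nu>
    using that by force
  have sp: "g \<in> span (\<alpha> ` I)" by (rule span_root[OF g(1)])
  have fin: "finite I" using finite_vertices by simp
  have B: "Base \<in> I" by simp
  have "Pos g" by (rule Pos_if_coord_Base[OF g])
  then have nonneg: "coord \<nu> g \<ge> 0" if "\<nu> \<in> I" for \<nu> using that by (simp add: Pos_def)
  \<comment> \<open>The terms at the arms are at most 0 and \<open>Base\<close> has coordinate 1, so
    its term must account for the whole value 2.\<close>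
  have "2 = form (\<alpha> Base) g + (\<Sum>\<nu>\<in>I - {Base}. coord \<nu> g * form (\<alpha> \<nu>) g)"
    using form_self_expand[OF sp] roots_norm2[OF g(1)] g(2) by (simp add: sum.remove[OF fin B])
  moreover have "(\<Sum>\<nu>\<in>I - {Base}. coord \<nu> g * form (\<alpha> \<nu>) g) \<le> 0"
    using neg nonneg by (intro sum_nonpos mult_nonneg_nonpos) auto
  ultimately have ge2: "form (\<alpha> Base) g \<ge> 2" by linarith
  have term_nonneg: "0 \<le> coord \<nu> g * - gram_entry Base \<nu>" if "\<nu> \<in> I - {Base}" for \<nu>
    using that nonneg[of \<nu>] gram_entry_cases[of Base \<nu>] by (intro mult_nonneg_nonneg) auto
  \<comment> \<open>Expanded by the Gram matrix, the same number is 2 minus the sum of the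
    coordinates at the first arm vertices. These are nonnegative and must therefore vanish.\<close>
  have "form (\<alpha> Base) g = 2 + (\<Sum>\<nu>\<in>I - {Base}. coord \<nu> g * gram_entry Base \<nu>)"
    using form_\<alpha>_expand[OF sp, of Base] g(2) by (simp add: sum.remove[OF fin B])
  then have "(\<Sum>\<nu>\<in>I - {Base}. coord \<nu> g * - gram_entry Base \<nu>) \<le> 0"
    using ge2 by (simp add: sum_negf)
  then have "(\<Sum>\<nu>\<in>I - {Base}. coord \<nu> g * - gram_entry Base \<nu>) = 0"
    using sum_nonneg[of "I - {Base}" "\<lambda>\<nu>. coord \<nu> g * - gram_entry Base \<nu>"] term_nonneg by auto
  then have zero: "coord \<nu> g * - gram_entry Base \<nu> = 0" if "\<nu> \<in> I - {Base}" for \<nu>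
    using sum_nonneg_eq_0_iff[of "I - {Base}" "\<lambda>\<nu>. coord \<nu> g * - gram_entry Base \<nu>"]
      fin term_nonneg that by blast
  \<comment> \<open>\<open>d\<close> continues the coordinates by 0 beyond the end of the arm, which
    makes the convexity inequality uniform up to the last vertex.\<close>
  define d where "d i j = (if Arm i j \<in> I then coord (Arm i j) g else 0)" for i j
  have d_nonneg: "d i j \<ge> 0" for i j using nonneg by (simp add: d_def)
  have d_1: "d i 1 = 0" for i using zero[of "Arm i 1"] by (simp add: d_def)
  have convex: "2 * d i (Suc j) \<le> d i j + d i (Suc (Suc j))" if "Arm i (Suc j) \<in> I" "j \<ge> 1" for i j
  proof -
    have "coord \<nu> g * gram_entry (Arm i (Suc j)) \<nu> =
        (if \<nu> = Arm i (Suc j) then 2 * coord \<nu> g else 0) - (if \<nu> = Arm i j then coord \<nu> g else 0)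
        - (if \<nu> = Arm i (Suc (Suc j)) then coord \<nu> g else 0)" if "\<nu> \<in> I" for \<nu>
      using that \<open>j \<ge> 1\<close> by (cases \<nu>) (auto simp: gram_entry_Arm)
    then have "form (\<alpha> (Arm i (Suc j))) g = (\<Sum>\<nu>\<in>I.
        (if \<nu> = Arm i (Suc j) then 2 * coord \<nu> g else 0) - (if \<nu> = Arm i j then coord \<nu> g else 0)
        - (if \<nu> = Arm i (Suc (Suc j)) then coord \<nu> g else 0))"
      using form_\<alpha>_expand[OF sp, of "Arm i (Suc j)"] that by simp
    also have "\<dots> = 2 * d i (Suc j) - d i j - d i (Suc (Suc j))"
      using fin that by (simp add: sum_subtractf d_def)
    finally show ?thesis using neg[of "Arm i (Suc j)"] that by simp
  qed
  have Arm_iff: "Arm i j \<in> I \<longleftrightarrow> 1 \<le> i \<and> i \<le> length p \<and> 1 \<le> j \<and> j \<le> p ! (i - 1)" for i j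
    by (auto simp: vertices_def)
  \<comment> \<open>Downward induction from the end of the arm, where the next value is 0.\<close>
  have decr: "d i (Suc j) \<le> d i j" if i: "1 \<le> i" "i \<le> length p" and j: "1 \<le> j" "j \<le> p ! (i - 1)" for i j
    using j(2)
  proof (induction rule: inc_induct)
    case base
    have "Arm i (Suc (p ! (i - 1))) \<notin> I" by (simp only: Arm_iff) simp
    then have "d i (Suc (p ! (i - 1))) = 0" unfolding d_def by (rule if_not_P)
    then show ?case using d_nonneg by simp
  next
    case (step n)
    then have "2 * d i (Suc n) \<le> d i n + d i (Suc (Suc n))"
      using i j by (intro convex) (simp_all only: Arm_iff, auto)
    then show ?case using step by linarith
  qed
  have d_0: "d i j = 0" if "Arm i j \<in> I" for i j
  proof -
    have ij: "1 \<le> i" "i \<le> length p" "1 \<le> j" "j \<le> p ! (i - 1)" using that Arm_iff by auto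
    from ij(3,4) have "d i j \<le> 0"
    proof (induction rule: dec_induct)
      case base
      then show ?case using d_1[of i] by simp
    next
      case (step n)
      then show ?case using decr[of i n] ij by simp
    qed
    then show ?thesis using d_nonneg[of i j] by simp
  qed
  have "coord \<nu> (g - \<alpha> Base) = 0" if "\<nu> \<in> I" for \<nu>
  proof (cases \<nu>)
    case (Arm i j)
    then show ?thesis using d_0[of i j] that coord_\<alpha>[OF that B] by (simp add: d_def)
  qed (use that g(2) coord_\<alpha>[OF that B] in auto)
  moreover have "g - \<alpha> Base \<in> span (\<alpha> ` I)" using sp B by (intro span_diff) (auto intro: span_base)
  ultimately have "g - \<alpha> Base = 0" using span_coord_zero by blast
  then show False using ne by simp
qed

lemma hgt_\<alpha>: "\<nu> \<in> I \<Longrightarrow> hgt (\<alpha> \<nu>) = 1"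
  using finite_vertices[of p] by (simp add: hgt_def coord_\<alpha> if_distrib cong: if_cong)

end

section \<open>Transitivity for a one-dimensional radical\<close>

locale nondegenerate_extended_space = extended_space p \<alpha> form
  for p :: "nat list" and \<alpha> :: "vertex \<Rightarrow> 'v::real_vector" and form :: "'v \<Rightarrow> 'v \<Rightarrow> real" +
  assumes nondegenerate: "v \<in> span (\<alpha> ` I) \<Longrightarrow> (\<And>u. form v u = 0) \<Longrightarrow> v = 0"
begin

context
  fixes \<nu>s :: "vertex list"
  assumes distinct_\<nu>s: "distinct \<nu>s" and set_\<nu>s: "set \<nu>s = vertices p - {Base, Base_star}"
begin

abbreviation "standard \<equiv> map \<alpha> (\<nu>s @ [Base, Base_star])"

text \<open>The invariant kept while the final pair is moved around: modulo \<open>\<delta>\<close>,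
  only the common root of the pair is still unknown.\<close>

definition lifted :: "'v list \<Rightarrow> 'v \<Rightarrow> 'v \<Rightarrow> bool" where
  "lifted ys g1 g2 \<longleftrightarrow> set (ys @ [g1, g2]) \<subseteq> ext_roots \<and> map proj ys = map \<alpha> \<nu>s \<and>
     proj g1 = proj g2 \<and> P (ys @ [g1, g2]) = P standard"

lemma set_\<nu>s_I: "set \<nu>s \<subseteq> I" "Base \<notin> set \<nu>s"
  using set_\<nu>s by auto

text \<open>Both products send \<open>v\<close> to \<open>W \<nu>s v\<close> plus a multiple of
  \<open>\<delta>\<close>. Comparing the multiples yields a vector that pairs to 0 with everything
  and lies in the span of the simple roots of \<open>I\<close>, so nondegeneracy makes it
  vanish.\<close>

lemma lifted_equation:
  assumes "lifted ys g1 g2"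
  shows "\<exists>x \<in> span (\<alpha> ` set \<nu>s). (x = 0 \<longrightarrow> ys = map \<alpha> \<nu>s) \<and>
    x + (rep Base_star g1 - rep Base_star g2) *\<^sub>R proj g1 + \<alpha> Base = 0"
proof -
  define g k l where "g = proj g1" and "k = rep Base_star g1" and "l = rep Base_star g2"
  have g12: "g1 = g + k *\<^sub>R \<delta>" "g2 = g + l *\<^sub>R \<delta>"
    using assms proj_plus_\<delta>[of g1] proj_plus_\<delta>[of g2] by (simp_all add: g_def k_def l_def lifted_def)
  have "g \<in> roots" using assms proj_roots by (simp add: g_def lifted_def)
  then have n: "form g g = 2" by (rule roots_norm2)
  obtain x where x: "x \<in> span (\<alpha> ` set \<nu>s)" "\<And>v. P ys v = W \<nu>s v + form x v *\<^sub>R \<delta>"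
    "x = 0 \<longrightarrow> ys = map \<alpha> \<nu>s"
    using lift_simple_product[of ys \<nu>s] assms set_\<nu>s_I distinct_\<nu>s by (auto simp: lifted_def)
  \<comment> \<open>The standard pair is the case of shifts 0 and 1 in
    \<open>pair_product\<close>.\<close>
  have B: "[\<alpha> Base, \<alpha> Base_star] = [\<alpha> Base + 0 *\<^sub>R \<delta>, \<alpha> Base + 1 *\<^sub>R \<delta>]"
    by (simp add: \<delta>_def)
  have "form (x + (k - l) *\<^sub>R g + \<alpha> Base) v = 0" for v
  proof -
    have "P (ys @ [g1, g2]) v = W \<nu>s v + (form x v + (k - l) * form g v) *\<^sub>R \<delta>"
      unfolding reflection_prod_append o_apply g12 pair_product[OF n] x(2)
      by (simp only: linear_add[OF linear_P] linear_scale[OF linear_P] P_\<delta>) (simp add: algebra_simps)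
    moreover have "P standard v = W \<nu>s v - form (\<alpha> Base) v *\<^sub>R \<delta>"
      unfolding map_append reflection_prod_append o_apply list.map B
      by (subst pair_product) (simp_all add: form_basis linear_diff[OF linear_P] linear_scale[OF linear_P] P_\<delta>
          del: reflection_prod_Cons)
    moreover have "P (ys @ [g1, g2]) = P standard" using assms by (simp only: lifted_def)
    ultimately have "W \<nu>s v + (form x v + (k - l) * form g v) *\<^sub>R \<delta> = W \<nu>s v - form (\<alpha> Base) v *\<^sub>R \<delta>"
      by (simp only:)
    then have "(form x v + (k - l) * form g v + form (\<alpha> Base) v) *\<^sub>R \<delta> = 0"
      by (simp add: algebra_simps)
    then have "form x v + (k - l) * form g v + form (\<alpha> Base) v = 0"
      using \<delta>_nonzero by (simp only: scaleR_eq_0_iff) simp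
    then show ?thesis by simp
  qed
  moreover have "x + (k - l) *\<^sub>R g + \<alpha> Base \<in> span (\<alpha> ` I)"
    using x(1) span_mono[of "\<alpha> ` set \<nu>s" "\<alpha> ` I"] set_\<nu>s_I span_root[OF \<open>g \<in> roots\<close>]
    by (intro span_add span_scale) (auto intro: span_base)
  ultimately have "x + (k - l) *\<^sub>R g + \<alpha> Base = 0" by (intro nondegenerate)
  then show ?thesis using x by (auto simp: g_def k_def l_def)
qed

text \<open>Read off \<open>lifted_equation\<close> at \<open>Base\<close>, where \<open>x\<close>
  contributes nothing as it lies in the span of the arms.\<close>

lemma lifted_coord:
  assumes "lifted ys g1 g2"
  shows "(rep Base_star g1 - rep Base_star g2) * coord Base (proj g1) = -1"
proof -
  have B: "Base \<in> I" by simp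
  obtain x where x: "x \<in> span (\<alpha> ` set \<nu>s)"
    "x + (rep Base_star g1 - rep Base_star g2) *\<^sub>R proj g1 + \<alpha> Base = 0"
    using lifted_equation[OF assms] by blast
  have "coord Base x = 0" by (rule coord_span_zero[OF x(1) set_\<nu>s_I(1) B set_\<nu>s_I(2)])
  moreover have "coord Base (x + (rep Base_star g1 - rep Base_star g2) *\<^sub>R proj g1 + \<alpha> Base) = 0"
    using x(2) B by (simp del: coord_proj)
  ultimately show ?thesis
    using B coord_\<alpha>[OF B B] by (simp del: coord_proj add: coord_simps[OF B])
qed

lemma lifted_heq:
  assumes "lifted ys g1 g2" "ys @ [g1, g2] \<simeq> zs @ [h1, h2]"
    "map proj zs = map proj ys" "proj h1 = proj h2"
  shows "lifted zs h1 h2"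
proof -
  have "set (ys @ [g1, g2]) \<subseteq> norm2"
    using assms(1) ext_roots_norm2 by (auto simp: lifted_def)
  then show ?thesis
    using assms heq_prod[OF assms(2)] heq_ext_roots[OF assms(2)] unfolding lifted_def by simp
qed

text \<open>Induction on the height of the common root. Unless it is \<open>\<alpha> Base\<close>,
  some arm root pairs positively with it, and conjugating the pair by the factor over that arm root
  lowers the height while the coordinate at \<open>Base\<close> stays 1.\<close>

lemma lifted_standard:
  assumes "lifted ys g1 g2" "coord Base (proj g1) = 1"
  shows "ys @ [g1, g2] \<simeq> standard"
  using assms
proof (induction "nat \<lfloor>hgt (proj g1)\<rfloor>" arbitrary: ys g1 g2 rule: less_induct)
  case less
  have r: "g1 \<in> ext_roots" "g2 \<in> ext_roots" "set ys \<subseteq> ext_roots" and ys: "map proj ys = map \<alpha> \<nu>s"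
    and eq: "proj g1 = proj g2"
    using less.prems(1) by (auto simp: lifted_def)
  show ?case
  proof (cases "proj g1 = \<alpha> Base")
    case True
    obtain m where m: "rep Base_star g1 = of_int m"
      using ext_roots_rep_Ints[OF r(1), of Base_star] Ints_cases by auto
    have l: "rep Base_star g2 = of_int m + 1"
      using lifted_coord[OF less.prems(1)] less.prems(2) m by simp
    obtain x where "x = 0 \<longrightarrow> ys = map \<alpha> \<nu>s"
      "x + (rep Base_star g1 - rep Base_star g2) *\<^sub>R proj g1 + \<alpha> Base = 0"
      using lifted_equation[OF less.prems(1)] by blast
    \<comment> \<open>The two shifts differ by 1, so \<open>lifted_equation\<close> reduces to
      \<open>x = 0\<close>.\<close>
    then have "ys = map \<alpha> \<nu>s" by (simp add: True m l)
    moreover have "g1 = \<alpha> Base + of_int m *\<^sub>R \<delta>" "g2 = \<alpha> Base + (of_int m + 1) *\<^sub>R \<delta>"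
      using proj_plus_\<delta>[of g1] proj_plus_\<delta>[of g2] True eq m l by simp_all
    ultimately show ?thesis
      using hurwitz_eq_context[OF heq_pair_shift[of m], of ys "[]"] by simp
  next
    case False
    have gr: "proj g1 \<in> roots" by (rule proj_roots[OF r(1)])
    obtain \<nu> where \<nu>: "\<nu> \<in> vertices p - {Base, Base_star}" "form (\<alpha> \<nu>) (proj g1) > 0"
      using arm_root_descent[OF gr less.prems(2) False] by blast
    then have \<nu>I: "\<nu> \<in> I" "\<nu> \<in> set \<nu>s" "\<nu> \<noteq> Base" using set_\<nu>s by auto
    have n: "form (\<alpha> \<nu>) (\<alpha> \<nu>) = 2" by (rule norm_\<alpha>[OF \<nu>I(1)])
    obtain as y bs where yb: "ys = as @ y # bs" "proj y = \<alpha> \<nu>"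
      using split_list[OF \<nu>I(2)] ys by (auto simp: map_eq_append_conv map_eq_Cons_conv)
    have norm: "set (as @ y # bs) \<subseteq> norm2" "form g1 g1 = 2" "form g2 g2 = 2"
      using r ext_roots_norm2 by (auto simp: yb)
    obtain zs h1 h2 where z: "ys @ [g1, g2] \<simeq> zs @ [h1, h2]" "map proj zs = map proj ys"
      "proj h1 = s (\<alpha> \<nu>) (proj g1)" "proj h2 = s (\<alpha> \<nu>) (proj g1)"
      using heq_pair_conjugate[OF norm eq] yb by auto
    have good: "lifted zs h1 h2" using lifted_heq[OF less.prems(1) z(1,2)] z(3,4) by simp
    have h1: "proj h1 = proj g1 - form (\<alpha> \<nu>) (proj g1) *\<^sub>R \<alpha> \<nu>"
      using n by (simp add: z(3) s_eq)
    have cB: "coord Base (proj h1) = 1"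
      unfolding h1 using less.prems(2) \<nu>I coord_\<alpha>[of Base \<nu>] by (simp del: coord_proj form_proj)
    have "form (\<alpha> \<nu>) (proj g1) \<in> \<int>"
      by (rule roots_form_Ints[OF roots_simple[OF \<nu>I(1)] gr])
    then have "form (\<alpha> \<nu>) (proj g1) \<ge> 1"
      using \<nu>(2) by (auto elim!: Ints_cases simp del: form_proj)
    then have le: "hgt (proj h1) \<le> hgt (proj g1) - 1"
      unfolding h1 by (simp add: hgt_\<alpha>[OF \<nu>I(1)] del: form_proj)
    have "proj h1 \<in> roots" using good proj_roots by (simp add: lifted_def)
    then have "hgt (proj h1) > 0" using Pos_hgt Pos_if_coord_Base cB by blast
    \<comment> \<open>Heights are real numbers here; a drop by at least 1 to a positive value lowers
      the floor.\<close>
    then have "nat \<lfloor>hgt (proj h1)\<rfloor> < nat \<lfloor>hgt (proj g1)\<rfloor>"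
      using le by linarith
    then have "zs @ [h1, h2] \<simeq> standard" using less.hyps good cB by blast
    then show ?thesis using z(1) hurwitz_eq.trans by blast
  qed
qed

theorem heq_standard:
  assumes xs: "set xs \<subseteq> ext_roots" "length xs = length \<nu>s + 2" "P xs = P standard"
  shows "xs \<simeq> standard"
proof -
  have B: "Base \<in> I" by simp
  \<comment> \<open>Modulo \<open>\<delta>\<close> the last two reflections of
    \<open>standard\<close> coincide and cancel.\<close>
  have "map proj standard = map \<alpha> \<nu>s @ [\<alpha> Base, \<alpha> Base]"
    using set_\<nu>s by auto
  then have "P (map proj standard) = W \<nu>s \<circ> (s (\<alpha> Base) \<circ> s (\<alpha> Base))"
    by (simp only: reflection_prod_append reflection_prod_Cons reflection_prod_Nil comp_id)
  then have "P (map proj standard) = W \<nu>s"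
    by (simp only: s_comp_s[OF norm_\<alpha>[OF B]] comp_id)
  then have "P (map proj xs) = W \<nu>s"
    using P_map_proj_cong[OF xs(3)] by (simp only:)
  moreover have "set (map proj xs) \<subseteq> roots" using xs(1) proj_roots by auto
  moreover have "length (map proj xs) = length \<nu>s + 2" using xs(2) by simp
  ultimately obtain c where "map proj xs \<simeq> map \<alpha> \<nu>s @ [c, c]"
    using heq_simple_pair[of "map proj xs" \<nu>s] set_\<nu>s_I distinct_\<nu>s by blast
  then obtain zs where zs: "xs \<simeq> zs" "map proj zs = map \<alpha> \<nu>s @ [c, c]"
    using heq_lift by blast
  then obtain ys g1 g2 where z: "zs = ys @ [g1, g2]" "map proj ys = map \<alpha> \<nu>s" "proj g1 = c" "proj g2 = c"
    by (auto simp: map_eq_append_conv map_eq_Cons_conv)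
  have "set xs \<subseteq> norm2" using xs(1) ext_roots_norm2 by auto
  then have l: "lifted ys g1 g2"
    using heq_prod[OF zs(1)] heq_ext_roots[OF zs(1) xs(1)] z xs(3) unfolding lifted_def by simp
  have r: "g1 \<in> ext_roots" "g2 \<in> ext_roots" using l by (auto simp: lifted_def)
  have "rep Base_star g1 - rep Base_star g2 \<in> \<int>" "coord Base (proj g1) \<in> \<int>"
    using ext_roots_rep_Ints[OF r(1)] ext_roots_rep_Ints[OF r(2)] coord_proj[OF B, of g1]
    by (simp_all add: coord_def)
  then obtain a b :: int where ab: "rep Base_star g1 - rep Base_star g2 = of_int a" "coord Base (proj g1) = of_int b"
    by (metis Ints_cases)
  then have "of_int (a * b) = (of_int (-1) :: real)" using lifted_coord[OF l] by simp
  then have "a * b = -1" by (simp only: of_int_eq_iff)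
  then have "b = 1 \<or> b = -1" by (metis dvd_triv_right zdvd1_eq dvd_minus_iff abs_eq_iff abs_1)
  then show ?thesis
  proof
    assume "b = 1"
    then show ?thesis using lifted_standard[OF l] ab(2) zs(1) z(1) hurwitz_eq.trans by auto
  next
    assume "b = -1"
    \<comment> \<open>Negating both roots changes no reflection but turns the coordinate at
      \<open>Base\<close> into 1.\<close>
    have "ys @ [g1, g2] \<simeq> ys @ [- g1, g2]"
      by (rule hurwitz_eq.neg[of form ys g1 "[g2]", simplified])
    also have "ys @ [- g1, g2] \<simeq> ys @ [- g1, - g2]"
      using hurwitz_eq.neg[of form "ys @ [- g1]" g2 "[]"] by simp
    finally have neg: "ys @ [g1, g2] \<simeq> ys @ [- g1, - g2]" .
    have "lifted ys (- g1) (- g2)"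
      by (rule lifted_heq[OF l neg]) (simp_all add: linear_neg[OF linear_proj] z)
    moreover have "coord Base (proj (- g1)) = 1"
      using ab(2) \<open>b = -1\<close> coord_simps(4)[OF B, of "proj g1"] by (simp add: linear_neg[OF linear_proj])
    ultimately have "ys @ [- g1, - g2] \<simeq> standard" by (rule lifted_standard)
    then show ?thesis using neg zs(1) z(1) hurwitz_eq.trans by blast
  qed
qed

end

end

section \<open>Reflections and the Hurwitz action\<close>

lemma group_prod_Cons [simp]: "group_prod G (x # xs) = x \<otimes>\<^bsub>G\<^esub> group_prod G xs"
  and group_prod_Nil [simp]: "group_prod G [] = \<one>\<^bsub>G\<^esub>"
  by (simp_all add: group_prod_def)

lemma one_GL: "\<one>\<^bsub>GL\<^esub> = id"
  and mult_GL: "f \<otimes>\<^bsub>GL\<^esub> g = f \<circ> g"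
  by (simp_all add: GL_def)

text \<open>The action evaluates a word picked by \<open>SOME\<close>; by
  \<open>hurwitz_word_cong\<close> every representative of the class gives the same result.\<close>

lemma hurwitz_action_eq:
  assumes G: "group G" and T: "T \<subseteq> carrier G" and w: "w \<in> braid_words n" and ts: "ts \<in> Red G T n c"
  shows "hurwitz_action G (Red G T n c) (braid_rel n `` {w}) ts = hurwitz_word G w ts"
proof -
  have "w \<in> braid_rel n `` {w}"
    using w by (simp add: braid_rel_def braid_eq.refl)
  then have "(SOME u. u \<in> braid_rel n `` {w}) \<in> braid_rel n `` {w}"
    by (rule someI)
  then have "braid_eq n w (SOME u. u \<in> braid_rel n `` {w})" by (simp add: braid_rel_def)
  then have "hurwitz_word G w ts = hurwitz_word G (SOME u. u \<in> braid_rel n `` {w}) ts"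
    using ts T by (intro hurwitz_word_cong[OF G]) (auto simp: Red_def)
  then show ?thesis using ts by (simp add: hurwitz_action_def)
qed

context symmetric_form
begin

lemma s_GL: "form a a = 2 \<Longrightarrow> s a \<in> carrier GL"
  using involuntory_imp_bij[of "s a"] linear_s[of a] by (simp add: GL_def)

lemma inv_s_GL: "form a a = 2 \<Longrightarrow> inv\<^bsub>GL\<^esub> (s a) = s a"
  by (rule group.inv_equality[OF group_GL]) (auto simp: s_GL, simp add: GL_def)

lemma group_prod_GL: "group_prod GL (map s xs) = P xs"
  by (induction xs) (auto simp: GL_def)

text \<open>\<open>right\<close> is a braid generator, \<open>left\<close> the inverse of one, and
  \<open>neg\<close> the empty word, as opposite roots have the same reflection. Words act from the
  right, so composing moves reverses their order.\<close>

lemma heq_braid_word: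
  assumes "xs \<simeq> ys" "set xs \<subseteq> norm2" "length xs = n"
  shows "\<exists>w \<in> braid_words n. hurwitz_word GL w (map s xs) = map s ys"
  using assms
proof (induction rule: hurwitz_eq.induct)
  case (refl xs)
  then show ?case by (intro bexI[of _ "[]"]) (auto simp: hurwitz_word_Nil braid_words_def)
next
  case (trans xs ys zs)
  obtain v where v: "v \<in> braid_words n" "hurwitz_word GL v (map s xs) = map s ys"
    using trans by blast
  have "set ys \<subseteq> norm2" "length ys = n"
    using heq_prod[OF trans.hyps(1)] hurwitz_eq_length[OF trans.hyps(1)] trans.prems by auto
  then obtain w where w: "w \<in> braid_words n" "hurwitz_word GL w (map s ys) = map s zs"
    using trans.IH by blast
  show ?case
    using v w braid_words_append by (intro bexI[of _ "w @ v"]) (auto simp: hurwitz_word_append)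
next
  case (right us a b vs)
  have n: "form a a = 2" "form b b = 2" using right.prems by auto
  \<comment> \<open>Generators are numbered from 1, so the one acting on the two entries after
    \<open>us\<close> is \<open>Suc (length us)\<close>.\<close>
  have "hurwitz_word GL [(True, Suc (length us))] (map s (us @ a # b # vs)) =
      map s us @ s b # (s b \<circ> s a \<circ> s b) # map s vs"
    using n by (simp add: hurwitz_word_Cons hurwitz_word_Nil Let_def nth_append list_update_append
        inv_s_GL) (simp add: GL_def)
  then show ?case
    using n right.prems by (intro bexI[of _ "[(True, Suc (length us))]"])
      (auto simp: braid_words_def s_conjugate)
next
  case (left us a b vs)
  have n: "form a a = 2" "form b b = 2" using left.prems by auto
  have "hurwitz_word GL [(False, Suc (length us))] (map s (us @ a # b # vs)) =
      map s us @ (s a \<circ> s b \<circ> s a) # s a # map s vs"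
    using n by (simp add: hurwitz_word_Cons hurwitz_word_Nil Let_def nth_append list_update_append
        inv_s_GL) (simp add: GL_def)
  then show ?case
    using n left.prems by (intro bexI[of _ "[(False, Suc (length us))]"])
      (auto simp: braid_words_def s_conjugate)
next
  case (neg us a vs)
  then show ?case by (intro bexI[of _ "[]"]) (auto simp: hurwitz_word_Nil braid_words_def)
qed

lemma s_P_GL:
  assumes "set xs \<subseteq> norm2"
  shows "P xs \<in> carrier GL" "P xs \<otimes>\<^bsub>GL\<^esub> s b \<otimes>\<^bsub>GL\<^esub> inv\<^bsub>GL\<^esub> (P xs) = s (P xs b)"
proof -
  interpret GL: group GL by (rule group_GL)
  have *: "P xs \<in> carrier GL" if "set xs \<subseteq> norm2" for xs
    using that
  proof (induction xs)
    case Nil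
    then show ?case unfolding reflection_prod_Nil one_GL[symmetric] by (intro GL.one_closed)
  next
    case (Cons x xs)
    then have "s x \<otimes>\<^bsub>GL\<^esub> P xs \<in> carrier GL" by (intro GL.m_closed s_GL) auto
    then show ?case by (simp only: reflection_prod_Cons mult_GL)
  qed
  show "P xs \<in> carrier GL" by (rule *[OF assms])
  have "P (rev xs) \<in> carrier GL" using assms by (intro *) simp
  moreover have "P (rev xs) \<otimes>\<^bsub>GL\<^esub> P xs = \<one>\<^bsub>GL\<^esub>"
    using P_rev(1)[OF assms] by (simp add: GL_def fun_eq_iff)
  ultimately have "inv\<^bsub>GL\<^esub> (P xs) = P (rev xs)"
    using *[OF assms] by (intro GL.inv_equality)
  then show "P xs \<otimes>\<^bsub>GL\<^esub> s b \<otimes>\<^bsub>GL\<^esub> inv\<^bsub>GL\<^esub> (P xs) = s (P xs b)"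
    by (simp only: mult_GL s_P_eq[OF assms])
qed

end

section \<open>The reflections of the extended Weyl system in terms of roots\<close>

context extended_space
begin

text \<open>Coordinate \<open>\<nu>\<close> of the image of \<open>\<alpha> \<nu>\<close> is -1
  under its own reflection and 1 under any other simple one. Hence counting simple reflections
  amounts to counting vertices.\<close>

lemma inj_on_simple_reflection: "inj_on (\<lambda>\<nu>. s (\<alpha> \<nu>)) (vertices p)"
proof (rule inj_onI)
  fix \<nu> \<omega> assume *: "\<nu> \<in> vertices p" "\<omega> \<in> vertices p" "s (\<alpha> \<nu>) = s (\<alpha> \<omega>)"
  have "rep \<nu> (s (\<alpha> \<nu>) (\<alpha> \<nu>)) = rep \<nu> (s (\<alpha> \<omega>) (\<alpha> \<nu>))" by (simp only: *(3))
  then show "\<nu> = \<omega>"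
    using *(1,2) by (simp add: s_eq form_basis rep_\<alpha> split: if_splits)
qed

lemma card_simple_reflections: "card (simple_reflections p \<alpha> form) = card (vertices p)"
  using card_image[OF inj_on_simple_reflection] by (simp add: simple_reflections_def image_image)

lemma weyl_group_eq: "weyl_group p \<alpha> form = {P xs | xs. set xs \<subseteq> \<alpha> ` vertices p}"
proof (intro Set.set_eqI iffI)
  fix w assume "w \<in> weyl_group p \<alpha> form"
  then show "w \<in> {P xs | xs. set xs \<subseteq> \<alpha> ` vertices p}"
    unfolding weyl_group_def
  proof (induction rule: generate.induct)
    case one
    have "\<one>\<^bsub>GL\<^esub> = P []" by (simp only: one_GL reflection_prod_Nil)
    then show ?case by (metis (mono_tags, lifting) empty_set empty_subsetI mem_Collect_eq)
  next
    case (incl h)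
    then obtain \<nu> where "\<nu> \<in> vertices p" "h = P [\<alpha> \<nu>]" by (auto simp: simple_reflections_def)
    then show ?case by (intro CollectI exI[of _ "[\<alpha> \<nu>]"]) auto
  next
    case (inv h)
    then obtain \<nu> where "\<nu> \<in> vertices p" "h = s (\<alpha> \<nu>)" by (auto simp: simple_reflections_def)
    then show ?case by (intro CollectI exI[of _ "[\<alpha> \<nu>]"]) (auto simp: inv_s_GL form_basis)
  next
    case (eng g h)
    then obtain xs ys where "set xs \<subseteq> \<alpha> ` vertices p" "set ys \<subseteq> \<alpha> ` vertices p" "g = P xs" "h = P ys"
      by blast
    then show ?case by (intro CollectI exI[of _ "xs @ ys"]) (auto simp: GL_def)
  qed
next
  fix w assume "w \<in> {P xs | xs. set xs \<subseteq> \<alpha> ` vertices p}"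
  then obtain xs where "set xs \<subseteq> \<alpha> ` vertices p" "w = P xs" by blast
  then show "w \<in> weyl_group p \<alpha> form"
    unfolding weyl_group_def
  proof (induction xs arbitrary: w)
    case Nil
    then have "w = \<one>\<^bsub>GL\<^esub>" by (simp only: one_GL reflection_prod_Nil)
    then show ?case by (simp only: generate.one)
  next
    case (Cons x xs)
    then have "P xs \<in> generate GL (simple_reflections p \<alpha> form)" by simp
    moreover have "s x \<in> simple_reflections p \<alpha> form"
      using Cons.prems(1) by (auto simp: simple_reflections_def)
    ultimately have "s x \<otimes>\<^bsub>GL\<^esub> P xs \<in> generate GL (simple_reflections p \<alpha> form)"
      by (intro generate.eng[OF generate.incl])
    then show ?case by (simp only: Cons.prems(2) reflection_prod_Cons mult_GL)
  qed
qed

lemma reflections_eq: "reflections p \<alpha> form = s ` ext_roots"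
proof (intro Set.set_eqI iffI)
  fix t assume "t \<in> reflections p \<alpha> form"
  then obtain xs \<nu> where xs: "set xs \<subseteq> \<alpha> ` vertices p" "\<nu> \<in> vertices p"
    "t = P xs \<otimes>\<^bsub>GL\<^esub> s (\<alpha> \<nu>) \<otimes>\<^bsub>GL\<^esub> inv\<^bsub>GL\<^esub> (P xs)"
    by (auto simp: reflections_def weyl_group_eq simple_reflections_def)
  then have "t = s (P xs (\<alpha> \<nu>))" using s_P_GL(2)[of xs] \<alpha>_ext_norm2 by auto
  moreover have "P xs (\<alpha> \<nu>) \<in> ext_roots"
    using xs by (intro root_system_P[OF \<alpha>_ext_norm2]) (auto intro: root_system.simple)
  ultimately show "t \<in> s ` ext_roots" by blast
next
  fix t assume "t \<in> s ` ext_roots"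
  then obtain b where b: "b \<in> ext_roots" "t = s b" by blast
  have "\<exists>xs \<nu>. set xs \<subseteq> \<alpha> ` vertices p \<and> \<nu> \<in> vertices p \<and> b = P xs (\<alpha> \<nu>)"
    using b(1)
  proof (induction rule: root_system.induct)
    case (simple a)
    then obtain \<nu> where "\<nu> \<in> vertices p" "a = P [] (\<alpha> \<nu>)" by auto
    then show ?case by (metis empty_set empty_subsetI)
  next
    case (reflect a b)
    then obtain xs \<nu> where "set xs \<subseteq> \<alpha> ` vertices p" "\<nu> \<in> vertices p" "b = P xs (\<alpha> \<nu>)" by blast
    then show ?case using reflect by (intro exI[of _ "a # xs"] exI[of _ \<nu>]) simp
  qed
  then obtain xs \<nu> where xs: "set xs \<subseteq> \<alpha> ` vertices p" "\<nu> \<in> vertices p" "b = P xs (\<alpha> \<nu>)" by blast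
  then have "t = P xs \<otimes>\<^bsub>GL\<^esub> s (\<alpha> \<nu>) \<otimes>\<^bsub>GL\<^esub> inv\<^bsub>GL\<^esub> (P xs)"
    using s_P_GL(2)[of xs] \<alpha>_ext_norm2 b(2) by auto
  then show "t \<in> reflections p \<alpha> form"
    using xs unfolding reflections_def weyl_group_eq simple_reflections_def by blast
qed

lemma reflections_conjugate:
  assumes "x \<in> reflections p \<alpha> form" "y \<in> reflections p \<alpha> form"
  shows "inv\<^bsub>GL\<^esub> y \<otimes>\<^bsub>GL\<^esub> x \<otimes>\<^bsub>GL\<^esub> y \<in> reflections p \<alpha> form \<and>
    y \<otimes>\<^bsub>GL\<^esub> x \<otimes>\<^bsub>GL\<^esub> inv\<^bsub>GL\<^esub> y \<in> reflections p \<alpha> form"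
proof -
  obtain a b where ab: "a \<in> ext_roots" "x = s a" "b \<in> ext_roots" "y = s b"
    using assms by (auto simp: reflections_eq)
  have n: "form b b = 2" by (rule ext_roots_norm2[OF ab(3)])
  have "s (s b a) \<in> s ` ext_roots" using ext_roots_closed ab by blast
  then show ?thesis
    unfolding ab(2,4) inv_s_GL[OF n] reflections_eq s_conjugate[OF n] by (simp add: GL_def)
qed

lemma reflections_carrier: "reflections p \<alpha> form \<subseteq> carrier GL"
  using s_GL ext_roots_norm2 by (auto simp: reflections_eq)

end

lemma length_coxeter_word:
  assumes "distinct \<nu>s" "set \<nu>s = vertices p - {Base, Base_star}"
  shows "length \<nu>s + 2 = card (vertices p)"
proof -
  have "length \<nu>s = card (vertices p - {Base, Base_star})"
    using distinct_card[OF assms(1)] assms(2) by simp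
  also have "\<dots> = card (vertices p) - 2"
    by (subst card_Diff_subset) auto
  finally show ?thesis
    using card_mono[OF finite_vertices, of "{Base, Base_star}" p] by simp
qed

lemma (in nondegenerate_extended_space) hurwitz_transitive:
  assumes n: "n = card (simple_reflections p \<alpha> form)" and c: "coxeter_transformation p \<alpha> form c"
  shows "transitive_action (braid_group n) (Red GL (reflections p \<alpha> form) n c)
    (hurwitz_action GL (Red GL (reflections p \<alpha> form) n c))"
proof -
  let ?E = "Red GL (reflections p \<alpha> form) n c"
  let ?\<phi> = "hurwitz_action GL ?E"
  interpret group_action "braid_group n" ?E ?\<phi>
    by (rule hurwitz_group_action[OF group_GL reflections_carrier reflections_conjugate])
  obtain \<nu>s where \<nu>s: "distinct \<nu>s" "set \<nu>s = vertices p - {Base, Base_star}"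
    and c_map: "c = group_prod GL (map (\<lambda>\<nu>. s (\<alpha> \<nu>)) (\<nu>s @ [Base, Base_star]))"
    using c unfolding coxeter_transformation_def by blast
  have "map (\<lambda>\<nu>. s (\<alpha> \<nu>)) xs = map s (map \<alpha> xs)" for xs by simp
  then have c_eq: "c = P (map \<alpha> (\<nu>s @ [Base, Base_star]))"
    by (simp only: c_map group_prod_GL)
  have "length \<nu>s + 2 = card (vertices p)" by (rule length_coxeter_word[OF \<nu>s])
  then have len: "n = length \<nu>s + 2" by (simp add: n card_simple_reflections)
  let ?std = "map s (map \<alpha> (\<nu>s @ [Base, Base_star]))"
  have orbit: "\<exists>X \<in> carrier (braid_group n). ?\<phi> X ts = ?std" if ts: "ts \<in> ?E" for ts
  proof -
    obtain xs where xs: "set xs \<subseteq> ext_roots" "ts = map s xs"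
    proof -
      have "ts \<in> lists (s ` ext_roots)" using ts by (auto simp: Red_def reflections_eq)
      then show ?thesis using that unfolding lists_image by auto
    qed
    have "length xs = n" "P xs = P (map \<alpha> (\<nu>s @ [Base, Base_star]))"
      using ts by (auto simp: Red_def xs(2) group_prod_GL c_eq)
    then have "xs \<simeq> map \<alpha> (\<nu>s @ [Base, Base_star])"
      using heq_standard[OF \<nu>s xs(1)] len by simp
    moreover have "set xs \<subseteq> norm2" using xs(1) ext_roots_norm2 by auto
    ultimately obtain w where w: "w \<in> braid_words n" "hurwitz_word GL w ts = ?std"
      using heq_braid_word \<open>length xs = n\<close> xs(2) by blast
    have "?\<phi> (braid_rel n `` {w}) ts = ?std"
      using hurwitz_action_eq[OF group_GL reflections_carrier w(1) ts] w(2) by simp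
    moreover have "braid_rel n `` {w} \<in> carrier (braid_group n)"
      using w(1) by (simp add: carrier_braid_group quotientI)
    ultimately show ?thesis by blast
  qed
  show ?thesis
  proof
    fix x y assume x: "x \<in> ?E" and y: "y \<in> ?E"
    obtain X where X: "X \<in> carrier (braid_group n)" "?\<phi> X x = ?std" using orbit[OF x] by blast
    obtain Y where Y: "Y \<in> carrier (braid_group n)" "?\<phi> Y y = ?std" using orbit[OF y] by blast
    interpret B: group "braid_group n" by (rule group_braid_group)
    let ?Z = "inv\<^bsub>braid_group n\<^esub> Y \<otimes>\<^bsub>braid_group n\<^esub> X"
    have "?\<phi> (inv\<^bsub>braid_group n\<^esub> Y) ?std = y" by (rule orbit_sym_aux[OF Y(1) y Y(2)])
    then have "?\<phi> ?Z x = y"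
      using composition_rule[OF x B.inv_closed[OF Y(1)] X(1)] X(2) by simp
    then show "\<exists>g \<in> carrier (braid_group n). ?\<phi> g x = y" using X(1) Y(1) by blast
  qed
qed

section \<open>The radical and the signature\<close>

text \<open>Dropping the zero entry \<open>i\<close> of the kernel vector leaves a nonzero kernel
  vector of the principal submatrix.\<close>

lemma eigenvalue_mat_delete:
  fixes A :: "real mat"
  assumes A: "A \<in> carrier_mat n n" and z: "z \<in> carrier_vec n" "z \<noteq> 0\<^sub>v n" "A *\<^sub>v z = 0\<^sub>v n"
    and i: "i < n" "z $ i = 0"
  shows "eigenvalue (mat_delete A i i) 0"
proof -
  obtain m where n: "n = Suc m" using i by (cases n) auto
  define z' where "z' = vec m (\<lambda>j. z $ insert_index i j)"
  have bij: "bij_betw (insert_index i) {0..<m} ({0..<n} - {i})"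
    using insert_index_image[of i m] insert_index_inj_on[of i "{0..<m}"] i n
    by (simp add: bij_betw_def)
  have D: "mat_delete A i i \<in> carrier_mat m m"
    using mat_delete_carrier[OF A, of i i] n by simp
  have "mat_delete A i i *\<^sub>v z' = 0\<^sub>v m"
  proof (rule eq_vecI)
    fix a assume "a < dim_vec (0\<^sub>v m)"
    then have a: "a < m" by simp
    then have ia: "insert_index i a < n" by (simp add: insert_index_def n)
    have "(mat_delete A i i *\<^sub>v z') $ a =
        (\<Sum>j\<in>{0..<m}. A $$ (insert_index i a, insert_index i j) * z $ insert_index i j)"
      using a D A i mat_delete_index[of A m i i a] n
      by (auto simp: scalar_prod_def z'_def intro!: sum.cong)
    also have "\<dots> = (\<Sum>k\<in>{0..<n} - {i}. A $$ (insert_index i a, k) * z $ k)"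
      by (rule sum.reindex_bij_betw[OF bij])
    also have "\<dots> = (\<Sum>k\<in>{0..<n}. A $$ (insert_index i a, k) * z $ k)"
      using i by (intro sum.mono_neutral_left) auto
    also have "\<dots> = (A *\<^sub>v z) $ insert_index i a"
      using A z(1) ia by (simp add: scalar_prod_def)
    finally show "(mat_delete A i i *\<^sub>v z') $ a = 0\<^sub>v m $ a" using z ia a by simp
  qed (use A n in simp)
  moreover have "z' \<noteq> 0\<^sub>v m"
  proof
    assume "z' = 0\<^sub>v m"
    then have 0: "z $ insert_index i j = 0" if "j < m" for j
      using that by (metis index_vec index_zero_vec(1) z'_def)
    have "z $ k = 0" if "k < n" for k
    proof (cases "k = i")
      case False
      then have "k \<in> insert_index i ` {0..<m}" using bij that by (auto simp: bij_betw_def)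
      then show ?thesis using 0 by auto
    qed (use i in simp)
    then have "z = 0\<^sub>v n" using z(1) by (intro eq_vecI) auto
    then show False using z(2) by simp
  qed
  ultimately have "eigenvector (mat_delete A i i) z' 0"
    using D by (auto simp: eigenvector_def z'_def)
  then show ?thesis by (auto simp: eigenvalue_def)
qed

text \<open>If the kernel had dimension at least two, every principal minor of size \<open>n - 1\<close> would vanish, and these
  minors sum up to the linear coefficient of the characteristic polynomial.\<close>

lemma kernel_if_order_one:
  fixes A :: "real mat"
  assumes A: "A \<in> carrier_mat n n" and order: "Polynomial.order 0 (char_poly A) = 1"
    and u: "u \<in> carrier_vec n" "A *\<^sub>v u = 0\<^sub>v n"
    and w: "w \<in> carrier_vec n" "A *\<^sub>v w = 0\<^sub>v n" "w \<noteq> 0\<^sub>v n"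
  shows "\<exists>c. u = c \<cdot>\<^sub>v w"
proof (rule ccontr)
  assume indep: "\<not> ?thesis"
  have "poly (char_poly (mat_delete A i i)) 0 = 0" if i: "i < n" for i
  proof -
    have "\<exists>z. z \<in> carrier_vec n \<and> z \<noteq> 0\<^sub>v n \<and> A *\<^sub>v z = 0\<^sub>v n \<and> z $ i = 0"
    proof (cases "w $ i = 0")
      case False
      \<comment> \<open>The factor is chosen to cancel entry \<open>i\<close>.\<close>
      let ?c = "u $ i / w $ i"
      have "u - ?c \<cdot>\<^sub>v w \<noteq> 0\<^sub>v n"
      proof
        assume 0: "u - ?c \<cdot>\<^sub>v w = 0\<^sub>v n"
        have "u $ j = (?c \<cdot>\<^sub>v w) $ j" if "j < n" for j
          using arg_cong[OF 0, of "\<lambda>v. v $ j"] that u w by simp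
        then have "u = ?c \<cdot>\<^sub>v w" using u w by (intro eq_vecI) auto
        then show False using indep by blast
      qed
      moreover have "A *\<^sub>v (u - ?c \<cdot>\<^sub>v w) = 0\<^sub>v n"
      proof -
        have "A *\<^sub>v (u - ?c \<cdot>\<^sub>v w) = A *\<^sub>v u - ?c \<cdot>\<^sub>v (A *\<^sub>v w)"
          using A u(1) w(1) by (simp add: mult_minus_distrib_mat_vec mult_mat_vec)
        also have "\<dots> = 0\<^sub>v n" unfolding u(2) w(2) by (intro eq_vecI) auto
        finally show ?thesis .
      qed
      ultimately show ?thesis
        using u w i False by (intro exI[of _ "u - ?c \<cdot>\<^sub>v w"]) auto
    qed (use w in blast)
    then have "eigenvalue (mat_delete A i i) 0"
      using eigenvalue_mat_delete[OF A] i by blast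
    then show ?thesis
      using eigenvalue_root_char_poly[OF mat_delete_carrier[OF A]] by blast
  qed
  \<comment> \<open>The derivative of the characteristic polynomial is the sum of the characteristic
    polynomials of the matrices \<open>mat_delete A i i\<close>.\<close>
  then have "poly (pderiv (char_poly A)) 0 = 0"
    by (simp add: pderiv_char_poly[OF A] poly_sum)
  moreover have "pderiv (char_poly A) \<noteq> 0"
  proof -
    have "n \<noteq> 0"
      using w(1,3) by (metis carrier_vecD eq_vecI index_zero_vec(2) less_nat_zero_code)
    then show ?thesis using degree_monic_char_poly[OF A] by (simp add: pderiv_eq_0_iff)
  qed
  ultimately have "Polynomial.order 0 (pderiv (char_poly A)) \<noteq> 0"
    by (simp add: order_root)
  moreover have "char_poly A \<noteq> 0" using degree_monic_char_poly[OF A] by auto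
  moreover then have "poly (char_poly A) 0 = 0" using order by (simp add: order_root)
  ultimately show False using order_pderiv[of "char_poly A" 0] order by simp
qed

section \<open>The kernel of the Gram matrix\<close>

context extended_space
begin

lemma sum_rep: "(\<Sum>\<omega>\<in>vertices p. rep \<omega> v *\<^sub>R \<alpha> \<omega>) = v"
proof -
  have "(\<Sum>\<omega>\<in>vertices p. rep \<omega> v *\<^sub>R \<alpha> \<omega>) =
      (\<Sum>b\<in>\<alpha> ` vertices p. representation (\<alpha> ` vertices p) v b *\<^sub>R b)"
    by (simp add: sum.reindex[OF inj_basis] rep_def)
  also have "\<dots> = v"
    using independent_basis span_basis finite_vertices by (intro real_vector.sum_representation_eq) auto
  finally show ?thesis .
qed

abbreviation rep_vec :: "'v \<Rightarrow> real vec" where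
  "rep_vec v \<equiv> vec (card (vertices p)) (\<lambda>a. rep (vertex_list p ! a) v)"

lemma gram_matrix_kernel:
  assumes "\<And>u. form v u = 0"
  shows "gram_matrix p *\<^sub>v rep_vec v = 0\<^sub>v (card (vertices p))"
proof (rule eq_vecI)
  let ?n = "card (vertices p)"
  fix a assume "a < dim_vec (0\<^sub>v ?n)"
  then have a: "a < ?n" by simp
  let ?\<nu> = "vertex_list p ! a"
  have \<nu>: "?\<nu> \<in> vertices p" using a nth_mem[of a "vertex_list p"] by (simp add: length_vertex_list set_vertex_list)
  have bij: "bij_betw ((!) (vertex_list p)) {0..<?n} (vertices p)"
    by (rule bij_betw_nth) (auto simp: distinct_vertex_list length_vertex_list set_vertex_list atLeast0LessThan)
  have "(gram_matrix p *\<^sub>v rep_vec v) $ a =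
      (\<Sum>b\<in>{0..<?n}. gram_entry ?\<nu> (vertex_list p ! b) * rep (vertex_list p ! b) v)"
    using a by (auto simp: gram_matrix_def scalar_prod_def intro!: sum.cong)
  also have "\<dots> = (\<Sum>\<omega>\<in>vertices p. gram_entry ?\<nu> \<omega> * rep \<omega> v)"
    by (rule sum.reindex_bij_betw[OF bij])
  also have "\<dots> = form (\<alpha> ?\<nu>) (\<Sum>\<omega>\<in>vertices p. rep \<omega> v *\<^sub>R \<alpha> \<omega>)"
    using \<nu> by (simp add: form_sum_right form_basis mult.commute)
  also have "\<dots> = 0"
    unfolding sum_rep using assms form_sym[of "\<alpha> ?\<nu>" v] by simp
  finally show "(gram_matrix p *\<^sub>v rep_vec v) $ a = 0\<^sub>v ?n $ a" using a by simp
qed (simp add: gram_matrix_def)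

lemma nondegenerate_if_signature:
  assumes "domestic p \<or> wild p"
  shows "nondegenerate_extended_space p \<alpha> form"
proof (unfold_locales, goal_cases)
  case (1 v)
  let ?n = "card (vertices p)"
  let ?A = "gram_matrix p"
  have A: "?A \<in> carrier_mat ?n ?n" by (simp add: gram_matrix_def)
  have "char_poly ?A \<noteq> 0" using degree_monic_char_poly[OF A] by auto
  then have order: "Polynomial.order 0 (char_poly ?A) = 1"
    using assms by (auto simp: domestic_def wild_def signature_def Let_def filter_eq_replicate_mset)
  have index: "\<exists>a < ?n. vertex_list p ! a = \<nu>" if "\<nu> \<in> vertices p" for \<nu>
    using that by (metis in_set_conv_nth length_vertex_list set_vertex_list)
  have eq_index: "rep \<nu> u = c * rep \<nu> w" if eq: "rep_vec u = c \<cdot>\<^sub>v rep_vec w" and \<nu>: "\<nu> \<in> vertices p"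
    for u w c \<nu>
  proof -
    obtain a where a: "a < ?n" "vertex_list p ! a = \<nu>" using index[OF \<nu>] by blast
    then show ?thesis using arg_cong[OF eq, of "\<lambda>x. x $ a"] by simp
  qed
  have "rep_vec \<delta> \<noteq> 0\<^sub>v ?n"
  proof
    assume 0: "rep_vec \<delta> = 0\<^sub>v ?n"
    obtain a where a: "a < ?n" "vertex_list p ! a = Base_star" using index[of Base_star] by auto
    then show False using arg_cong[OF 0, of "\<lambda>x. x $ a"] by simp
  qed
  then obtain c where c: "rep_vec v = c \<cdot>\<^sub>v rep_vec \<delta>"
    using kernel_if_order_one[OF A order, of "rep_vec v" "rep_vec \<delta>"]
      gram_matrix_kernel[of v] gram_matrix_kernel[of \<delta>] 1(2) by auto
  have "rep Base_star v = 0"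
    using 1(1)
  proof (induction rule: span_induct_alt)
    case (step c x y)
    then show ?case by (auto simp: rep_\<alpha>)
  qed simp
  then have "c = 0" using eq_index[OF c, of Base_star] by simp
  then have "rep \<nu> v = 0" if "\<nu> \<in> vertices p" for \<nu> using eq_index[OF c that] by simp
  then show "v = 0" using sum_rep[of v] by simp
qed

end

theorem theorem1p1:
  fixes p :: "nat list"
    and \<alpha> :: "vertex \<Rightarrow> 'v::real_vector"
    and form :: "'v \<Rightarrow> 'v \<Rightarrow> real"
    and c :: "'v \<Rightarrow> 'v"
    and n :: nat
  assumes "extended_space p \<alpha> form"
    and "domestic p \<or> wild p"
    and "n = card (simple_reflections p \<alpha> form)"
    and "coxeter_transformation p \<alpha> form c"
  shows "transitive_action (braid_group n)
           (Red GL (reflections p \<alpha> form) n c)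
           (hurwitz_action GL (Red GL (reflections p \<alpha> form) n c))"
proof -
  interpret nondegenerate_extended_space p \<alpha> form
    using extended_space.nondegenerate_if_signature assms(1,2) .
  show ?thesis using hurwitz_transitive assms(3,4) .
qed

end
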